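(* Let $X$ be a standard Borel space with a Borel probability measure $\mu$ and let $T\colon X\to X$ be a $\mu$-measurable map preserving $\mu$. Let $Y$ be a Polish space and let $S \colon Y \to Y$ be a continuous map. Let $p \colon Y \to X$ be a Borel map such that $p \circ S=T\circ p$ and $\mu(p(Y))=1$. Suppose that for $\mu$-almost all $x\in X$ the set $p^{-1}(x)$ is compact. Then there exists a Borel probability measure $\nu$ on $Y$ which is $S$-invariant (i.e. $S_*(\nu)=\nu$) and satisfies $p_*(\nu)=\mu$.
   Context: A Polish space is a separable, completely metrizable topological space. A standard Borel space is an uncountable set $X$ with a $\sigma$-algebra $\Sigma$ of subsets of $X$ (its Borel sets) such that there exists a Polish topology on $X$ whose Borel $\sigma$-algebra is $\Sigma$. A map $T\colon X\to X$ is $\mu$-measurable if preimages of Borel sets are $\mu$-measurable, i.e. belong to the completion of the Borel $\sigma$-algebra with respect to $\mu$; it preserves $\mu$ if $\mu(T^{-1}(A))=\mu(A)$ for all Borel $A\subset X$, where $\mu$ also denotes the completed measure. For a map $f$ and a measure $\sigma$, $f_*(\sigma)$ denotes the push-forward measure, $f_*(\sigma)(A)=\sigma(f^{-1}(A))$. The set $p(Y)$ is analytic, hence $\mu$-measurable, and $\mu(p(Y))$ is understood with respect to the completion of $\mu$. *)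

theory Defs
  imports "HOL-Probability.Probability"
begin

definition separable_topology :: "'a topology \<Rightarrow> bool" where
  "separable_topology X \<longleftrightarrow>
     (\<exists>D. countable D \<and> D \<subseteq> topspace X \<and> X closure_of D = topspace X)"

definition polish_topology :: "'a topology \<Rightarrow> bool" where
  "polish_topology X \<longleftrightarrow> separable_topology X \<and> completely_metrizable_space X"

definition borel_of :: "'a topology \<Rightarrow> 'a measure" where
  "borel_of X = sigma (topspace X) {U. openin X U}"

lemma space_borel_of: "space (borel_of X) = topspace X"
  by (simp add: borel_of_def space_measure_of_conv)

lemma sets_borel_of: "sets (borel_of X) = sigma_sets (topspace X) {U. openin X U}"
  unfolding borel_of_def by (rule sets_measure_of) (auto dest: openin_subset)

text \<open>Only the measurable-space part of \<open>M\<close> is used. Equality of the two \<open>\<sigma>\<close>-algebras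
  also forces \<open>topspace \<tau> = space M\<close>.\<close>

definition standard_borel_space :: "'a measure \<Rightarrow> bool" where
  "standard_borel_space M \<longleftrightarrow>
     uncountable (space M) \<and> (\<exists>\<tau>. polish_topology \<tau> \<and> sets (borel_of \<tau>) = sets M)"

end

theory Submission
  imports Defs
begin

text \<open>
  For \<open>A \<subseteq> Y\<close> let \<open>c A\<close> be the outer \<open>\<mu>\<close>-measure of \<open>p(A)\<close>. A measure \<open>\<nu>\<close> on \<open>Y\<close> with total mass 1
  satisfies \<open>p\<^sub>*\<nu> = \<mu>\<close> as soon as \<open>\<nu> C \<le> c C\<close> for every closed \<open>C\<close>: inner regularity then gives
  \<open>\<nu> (p\<inverse>(A)) \<le> \<mu> A\<close> for all \<open>A\<close>, and two probability measures comparable in this way are equal. So the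
  task is to find an invariant measure below \<open>c\<close>, and this is done with finitely additive set
  functions defined on \<^emph>\<open>all\<close> subsets, where no measurability gets in the way.

  Two properties of \<open>c\<close> are formal. It is submodular, because outer measures are, and a minimal
  submodular function below \<open>c\<close> is additive (\<open>submodular_dominates_modular\<close>). Moreover
  \<open>c (S\<inverse>(A)) \<le> c A\<close>, because \<open>p (S\<inverse>(A)) \<subseteq> T\<inverse>(p(A))\<close> and \<open>T\<close> preserves \<open>\<mu>\<close>; so Cesaro averages along
  \<open>S\<close> stay below \<open>c\<close>, and a limit of them is an \<open>S\<close>-invariant, finitely additive \<open>L \<le> c\<close>
  (\<open>modular_invariant_limit\<close>).

  The third property is where compact fibres enter: \<open>c (C\<^sub>n) \<longlonglongrightarrow> c (\<Inter>C\<^sub>n)\<close> for decreasing closed sets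
  (\<open>image_capacity_decseq_closed\<close>). By compactness \<open>\<Inter>p(C\<^sub>n)\<close> and \<open>p(\<Inter>C\<^sub>n)\<close> agree up to a null set, but
  outer measures are in general continuous along decreasing sequences only on measurable sets. One therefore
  has to know that images of closed sets under a Borel map are \<open>\<mu>\<close>-measurable
  (\<open>borel_image_closed_completion_measurable\<close>), which is Lusin's theorem on analytic sets; it is
  proved here by a capacity argument.

  In particular \<open>L (C\<^sub>n) \<longlonglongrightarrow> 0\<close> for closed \<open>C\<^sub>n\<close> decreasing to the empty set. Like a content in the
  Riesz representation theorem, such an \<open>L\<close> induces a Borel measure \<open>\<nu>\<close> whose value on an open set is
  the supremum of \<open>L\<close> over its closed subsets (\<open>representing_measure\<close>). Squeezing a closed set between
  open and closed neighbourhoods transfers \<open>L \<le> c\<close> to \<open>\<nu> C \<le> c C\<close>. Since \<open>S\<close> is continuous,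
  \<open>S\<inverse>(C)\<close> is closed with \<open>L (S\<inverse>(C)) = L C\<close> whenever \<open>C\<close> is closed; hence \<open>\<nu> (S\<inverse>(U)) \<ge> \<nu> U\<close> for open
  \<open>U\<close>, and regularity upgrades this to \<open>S\<^sub>*\<nu> = \<nu>\<close>.
\<close>

section \<open>Additive set functions below submodular ones\<close>

definition submodular :: "('a set \<Rightarrow> real) \<Rightarrow> bool" where
  "submodular c \<longleftrightarrow> c {} = 0 \<and> mono c \<and> (\<forall>A B. c (A \<union> B) + c (A \<inter> B) \<le> c A + c B)"

definition modular :: "('a set \<Rightarrow> real) \<Rightarrow> bool" where
  "modular m \<longleftrightarrow> m {} = 0 \<and> mono m \<and> (\<forall>A B. m (A \<union> B) + m (A \<inter> B) = m A + m B)"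

lemma submodular_nonneg: "submodular c \<Longrightarrow> 0 \<le> c A"
  unfolding submodular_def by (metis empty_subsetI monoD)

lemma modular_imp_submodular: "modular m \<Longrightarrow> submodular m"
  by (simp add: submodular_def modular_def)

text \<open>
  The new function is the direct sum of the restriction of \<open>c\<close> to \<open>B\<close> and the contraction of \<open>c\<close> by
  \<open>B\<close>. By submodularity it lies below \<open>c\<close>, with the same value on the whole space, and it is strictly
  smaller at \<open>A\<close> unless \<open>c\<close> is already modular at the pair \<open>A, B\<close>.
\<close>

lemma submodular_contract:
  assumes "submodular c"
  shows "submodular (\<lambda>A. c (A \<inter> B) + c (A \<union> B) - c B)"
proof -
  have c0: "c {} = 0" and m: "mono c" and s: "c (A \<union> C) + c (A \<inter> C) \<le> c A + c C" for A C
    using assms by (auto simp: submodular_def)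
  have "c ((A \<union> C) \<inter> B) + c ((A \<union> C) \<union> B) - c B + (c ((A \<inter> C) \<inter> B) + c ((A \<inter> C) \<union> B) - c B)
     \<le> c (A \<inter> B) + c (A \<union> B) - c B + (c (C \<inter> B) + c (C \<union> B) - c B)" for A C
  proof -
    have "(A \<inter> B) \<union> (C \<inter> B) = (A \<union> C) \<inter> B" "(A \<inter> B) \<inter> (C \<inter> B) = (A \<inter> C) \<inter> B"
      "(A \<union> B) \<union> (C \<union> B) = (A \<union> C) \<union> B" "(A \<union> B) \<inter> (C \<union> B) = (A \<inter> C) \<union> B" by auto
    then show ?thesis
      using s[of "A \<inter> B" "C \<inter> B"] s[of "A \<union> B" "C \<union> B"] by simp
  qed
  moreover have "mono (\<lambda>A. c (A \<inter> B) + c (A \<union> B) - c B)"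
    by (intro monoI diff_right_mono add_mono) (auto intro!: monoD[OF m])
  ultimately show ?thesis
    unfolding submodular_def using c0 by simp
qed

lemma submodular_INF_chain:
  fixes \<C> :: "('a set \<Rightarrow> real) set"
  assumes ne: "\<C> \<noteq> {}" and sub: "\<And>f. f \<in> \<C> \<Longrightarrow> submodular f"
    and chain: "\<And>f g. f \<in> \<C> \<Longrightarrow> g \<in> \<C> \<Longrightarrow> f \<le> g \<or> g \<le> f"
  shows "submodular (\<lambda>A. INF f\<in>\<C>. f A)"
proof -
  let ?u = "\<lambda>A. INF f\<in>\<C>. f A"
  have bdd: "bdd_below ((\<lambda>f. f A) ` \<C>)" for A
    using submodular_nonneg[OF sub] by (intro bdd_belowI[of _ 0]) auto
  have lower: "?u A \<le> f A" if "f \<in> \<C>" for A f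
    using bdd that by (rule cINF_lower)
  have "?u {} = (INF f\<in>\<C>. (0::real))"
    using sub by (intro INF_cong) (auto simp: submodular_def)
  then have u0: "?u {} = 0" using ne by simp
  have mono: "mono ?u"
  proof (rule monoI)
    fix A B :: "'a set" assume "A \<subseteq> B"
    then show "?u A \<le> ?u B"
      using sub unfolding submodular_def
      by (intro cINF_mono[OF ne bdd]) (meson monoD)
  qed
  have "?u (A \<union> B) + ?u (A \<inter> B) \<le> ?u A + ?u B" for A B
  proof -
    have *: "?u (A \<union> B) + ?u (A \<inter> B) \<le> f A + g B" if fg: "f \<in> \<C>" "g \<in> \<C>" for f g
    proof -
      obtain h where h: "h \<in> \<C>" "h \<le> f" "h \<le> g"
        using chain[OF fg] fg by blast
      have "?u (A \<union> B) + ?u (A \<inter> B) \<le> h (A \<union> B) + h (A \<inter> B)"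
        using lower[OF h(1)] by (intro add_mono)
      also have "\<dots> \<le> h A + h B" using sub[OF h(1)] by (simp add: submodular_def)
      also have "\<dots> \<le> f A + g B" using h by (intro add_mono) (auto simp: le_fun_def)
      finally show ?thesis .
    qed
    have "?u (A \<union> B) + ?u (A \<inter> B) - g B \<le> ?u A" if "g \<in> \<C>" for g
      by (rule cINF_greatest[OF ne]) (use *[OF _ that] in fastforce)
    then have "?u (A \<union> B) + ?u (A \<inter> B) - ?u A \<le> g B" if "g \<in> \<C>" for g
      using that by (smt (verit))
    then have "?u (A \<union> B) + ?u (A \<inter> B) - ?u A \<le> ?u B"
      by (rule cINF_greatest[OF ne])
    then show ?thesis by simp
  qed
  with u0 mono show ?thesis unfolding submodular_def by blast
qed

text \<open>
  The Hahn-Banach theorem for set functions. A minimal submodular \<open>m \<le> c\<close> of full mass exists by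
  Zorn's lemma, and \<open>submodular_contract\<close> cannot decrease it, which says that \<open>m\<close> is modular.
\<close>

lemma submodular_dominates_modular:
  fixes c :: "'a set \<Rightarrow> real"
  assumes c: "submodular c"
  obtains m where "modular m" "m UNIV = c UNIV" "m \<le> c"
proof -
  define \<S> where "\<S> = {f. submodular f \<and> f UNIV = c UNIV \<and> f \<le> c}"
  have po: "partial_order_on \<S> (relation_of (\<lambda>f g. g \<le> f) \<S>)"
    by (rule partial_order_on_relation_ofI) auto
  have ch: "\<exists>u\<in>\<S>. \<forall>f\<in>\<C>. u \<le> f" if "\<C> \<in> Chains (relation_of (\<lambda>f g. g \<le> f) \<S>)" for \<C>
  proof (cases "\<C> = {}")
    case True
    then show ?thesis using c by (auto simp: \<S>_def)
  next
    case False
    have chain: "f \<in> \<S> \<and> (f \<le> g \<or> g \<le> f)" if "f \<in> \<C>" "g \<in> \<C>" for f g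
      using \<open>\<C> \<in> _\<close> that unfolding Chains_def relation_of_def by auto
    have lower: "(INF f\<in>\<C>. f A) \<le> f A" if "f \<in> \<C>" for A f
      using chain submodular_nonneg that
      by (intro cINF_lower bdd_belowI[of _ 0]) (auto simp: \<S>_def)
    have "submodular (\<lambda>A. INF f\<in>\<C>. f A)"
      using chain by (intro submodular_INF_chain[OF False]) (auto simp: \<S>_def)
    moreover have "(INF f\<in>\<C>. f UNIV) = (INF f\<in>\<C>. c UNIV)"
      using chain by (intro INF_cong) (auto simp: \<S>_def)
    moreover obtain f where "f \<in> \<C>" using False by blast
    then have "(\<lambda>A. INF f\<in>\<C>. f A) \<le> c"
      using lower[of f] chain[of f f] by (force simp: le_fun_def \<S>_def intro: order_trans)
    ultimately have "(\<lambda>A. INF f\<in>\<C>. f A) \<in> \<S>"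
      using False by (simp add: \<S>_def)
    then show ?thesis using lower by (intro bexI[of _ "\<lambda>A. INF f\<in>\<C>. f A"]) (auto simp: le_fun_def)
  qed
  obtain m where m: "m \<in> \<S>" and min: "\<And>f. f \<in> \<S> \<Longrightarrow> f \<le> m \<Longrightarrow> m = f"
    using predicate_Zorn[OF po ch] by blast
  then have sm: "submodular m" by (simp add: \<S>_def)
  have "m (A \<union> B) + m (A \<inter> B) = m A + m B" for A B
  proof -
    let ?f = "\<lambda>A. m (A \<inter> B) + m (A \<union> B) - m B"
    have le: "?f \<le> m"
    proof (rule le_funI)
      fix C show "?f C \<le> m C"
        using sm unfolding submodular_def by (smt (verit))
    qed
    have "?f UNIV = m UNIV" by simp
    then have "?f \<in> \<S>"
      using submodular_contract[OF sm, of B] m le unfolding \<S>_def by auto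
    then have "m = ?f" using le by (rule min)
    then have "m A = ?f A" by (rule fun_cong)
    then show ?thesis by simp
  qed
  then have "modular m" using sm by (simp add: submodular_def modular_def)
  with that m show ?thesis by (auto simp: \<S>_def)
qed

lemma modular_average:
  assumes "\<And>k. modular (f k)" "finite K"
  shows "modular (\<lambda>A. (\<Sum>k\<in>K. f k A) / real n)"
proof -
  have "(\<Sum>k\<in>K. f k (A \<union> B)) + (\<Sum>k\<in>K. f k (A \<inter> B)) = (\<Sum>k\<in>K. f k A) + (\<Sum>k\<in>K. f k B)" for A B
    unfolding sum.distrib[symmetric] using assms(1) by (intro sum.cong) (auto simp: modular_def)
  then have "(\<Sum>k\<in>K. f k (A \<union> B)) / n + (\<Sum>k\<in>K. f k (A \<inter> B)) / n
      = (\<Sum>k\<in>K. f k A) / n + (\<Sum>k\<in>K. f k B) / n" for A B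
    unfolding add_divide_distrib[symmetric] by simp
  moreover have "mono (\<lambda>A. (\<Sum>k\<in>K. f k A) / real n)"
    using assms(1) by (intro monoI divide_right_mono sum_mono) (auto simp: modular_def dest: monoD)
  ultimately show ?thesis
    using assms(1) by (simp add: modular_def)
qed

text \<open>
  The Krylov-Bogolyubov argument for set functions. The averages \<open>a n\<close> of the pullbacks of \<open>m\<close> live in
  the compact space \<open>[0,1]\<close> to the power of all subsets, and all claimed properties are closed under
  limits along a filter.
\<close>

lemma modular_invariant_limit:
  fixes c :: "'a set \<Rightarrow> real" and g :: "'a \<Rightarrow> 'a"
  assumes m: "modular m" "m UNIV = 1" and dom: "m \<le> c" and inv: "\<And>A. c (g -` A) \<le> c A"
  obtains L where "modular L" "L UNIV = 1" "L \<le> c" "\<And>A. L (g -` A) = L A"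
proof -
  have m01: "0 \<le> m A" "m A \<le> 1" for A
    using submodular_nonneg[OF modular_imp_submodular[OF m(1)]] m unfolding modular_def
    by (auto dest: monoD[of m A UNIV])
  define f where "f k A = m ((g ^^ k) -` A)" for k A
  have f_c: "f k A \<le> c A" for k A
  proof (induction k arbitrary: A)
    case 0
    then show ?case using dom by (simp add: f_def le_fun_def)
  next
    case (Suc k)
    have "f (Suc k) A = f k (g -` A)"
      by (simp add: f_def vimage_def)
    also have "\<dots> \<le> c A" using Suc inv order_trans by blast
    finally show ?case .
  qed
  have mod_f: "modular (f k)" for k
    using m unfolding modular_def f_def
    by (auto intro!: monoI dest: monoD[OF _ vimage_mono] simp: vimage_Un vimage_Int)
  define a where "a n = (\<lambda>A. (\<Sum>k<Suc n. f k A) / Suc n)" for n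
  have mod_a: "modular (a n)" for n
    unfolding a_def by (rule modular_average) (use mod_f in auto)
  have a_le: "a n A \<le> b" if "\<And>k. f k A \<le> b" for n A b
  proof -
    have "(\<Sum>k<Suc n. f k A) \<le> (\<Sum>k<Suc n. b)" by (intro sum_mono that)
    then show ?thesis by (simp add: a_def divide_simps algebra_simps)
  qed
  have a0: "0 \<le> a n A" for n A
    unfolding a_def f_def using m01 by (intro divide_nonneg_nonneg sum_nonneg) auto
  have a1: "a n A \<le> 1" for n A using m01 by (intro a_le) (simp add: f_def)
  have aU: "a n UNIV = 1" for n using m by (simp add: a_def f_def)
  have a_diff: "\<bar>a n (g -` A) - a n A\<bar> \<le> 1 / Suc n" for n A
  proof -
    \<comment> \<open>the averages over consecutive windows differ by two boundary terms only\<close>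
    have "(\<Sum>k<Suc n. f k (g -` A)) - (\<Sum>k<Suc n. f k A) = (\<Sum>k<Suc n. f (Suc k) A - f k A)"
      by (simp add: sum_subtractf f_def vimage_def)
    also have "\<dots> = f (Suc n) A - f 0 A" by (rule sum_lessThan_telescope)
    finally have "a n (g -` A) - a n A = (f (Suc n) A - f 0 A) / Suc n"
      by (simp add: a_def diff_divide_distrib[symmetric])
    moreover have "\<bar>f (Suc n) A - f 0 A\<bar> \<le> 1"
      using m01[of "(g ^^ Suc n) -` A"] m01[of A] by (simp add: f_def abs_le_iff)
    ultimately show ?thesis by (simp add: abs_divide divide_right_mono del: of_nat_Suc)
  qed
  \<comment> \<open>The sequence \<open>a\<close> need not have a convergent subsequence in this uncountable product; the
    filter \<open>F\<close> around a cluster point plays the role of one.\<close>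
  have "compactin (product_topology (\<lambda>A::'a set. euclideanreal) UNIV) (PiE UNIV (\<lambda>A. {0..1}))"
    by (subst compactin_PiE) auto
  then have cpt: "compact (PiE UNIV (\<lambda>A::'a set. {0..1::real}))"
    by (simp add: euclidean_product_topology)
  have "filtermap a sequentially \<noteq> bot" by (simp add: filtermap_bot_iff)
  moreover have "\<forall>\<^sub>F h in filtermap a sequentially. h \<in> PiE UNIV (\<lambda>A. {0..1})"
    using a0 a1 by (simp add: eventually_filtermap PiE_iff)
  ultimately obtain L where L: "inf (nhds L) (filtermap a sequentially) \<noteq> bot"
    using cpt unfolding compact_filter by blast
  define F where "F = inf (nhds L) (filtermap a sequentially)"
  have F: "F \<noteq> bot" "F \<le> nhds L" "F \<le> filtermap a sequentially"
    using L by (auto simp: F_def)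
  have lim: "((\<lambda>h. h A) \<longlongrightarrow> L A) F" for A
  proof -
    have "continuous_on UNIV (\<lambda>h::'a set \<Rightarrow> real. h A)"
      by (rule continuous_on_product_coordinates)
    then have "open ((\<lambda>h::'a set \<Rightarrow> real. h A) -` S)" if "open S" for S
      using that unfolding continuous_on_open_vimage[OF open_UNIV] by (metis Int_UNIV_right)
    then have "((\<lambda>h::'a set \<Rightarrow> real. h A) \<longlongrightarrow> L A) (nhds L)"
      unfolding eventually_nhds tendsto_def by (metis vimage_eq)
    then show ?thesis using F(2) by (rule tendsto_mono[rotated])
  qed
  have ev: "eventually P F" if "\<And>n. P (a n)" for P
    using F(3) that by (auto simp: le_filter_def eventually_filtermap)
  have "L (A \<union> B) + L (A \<inter> B) = L A + L B" for A B
  proof (rule tendsto_unique[OF F(1)])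
    show "((\<lambda>h. h A + h B) \<longlongrightarrow> L A + L B) F" by (intro tendsto_intros lim)
    have "((\<lambda>h. h (A \<union> B) + h (A \<inter> B)) \<longlongrightarrow> L (A \<union> B) + L (A \<inter> B)) F" by (intro tendsto_intros lim)
    moreover have "\<forall>\<^sub>F h in F. h (A \<union> B) + h (A \<inter> B) = h A + h B"
      by (rule ev) (use mod_a in \<open>simp add: modular_def\<close>)
    ultimately show "((\<lambda>h. h A + h B) \<longlongrightarrow> L (A \<union> B) + L (A \<inter> B)) F"
      by (simp cong: tendsto_cong)
  qed
  moreover have "mono L"
  proof (rule monoI)
    fix A B :: "'a set" assume "A \<subseteq> B"
    then have "\<forall>\<^sub>F h in F. h A \<le> h B"
      by (intro ev) (use mod_a in \<open>auto simp: modular_def dest: monoD\<close>)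
    then show "L A \<le> L B" by (rule tendsto_le[OF F(1) lim lim])
  qed
  moreover have const: "L A = b" if "\<And>n. a n A = b" for A b
  proof (rule tendsto_unique[OF F(1) lim])
    have "\<forall>\<^sub>F h in F. h A = b" by (rule ev) (rule that)
    then show "((\<lambda>h. h A) \<longlongrightarrow> b) F" by (rule tendsto_eventually)
  qed
  have "L {} = 0" by (rule const) (use mod_a in \<open>simp add: modular_def\<close>)
  moreover have "L \<le> c"
  proof (rule le_funI)
    fix A
    have "\<forall>\<^sub>F h in F. h A \<le> c A" by (rule ev) (simp add: a_le f_c)
    then show "L A \<le> c A" using tendsto_upperbound[OF lim _ F(1)] by blast
  qed
  moreover have "L (g -` A) = L A" for A
  proof -
    have "(\<lambda>n. a n (g -` A) - a n A) \<longlonglongrightarrow> 0"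
      by (rule Lim_null_comparison[OF _ LIMSEQ_inverse_real_of_nat])
         (use a_diff in \<open>simp add: inverse_eq_divide\<close>)
    then have "((\<lambda>h. h (g -` A) - h A) \<longlongrightarrow> 0) (filtermap a sequentially)"
      by (simp add: filterlim_filtermap)
    then have "((\<lambda>h. h (g -` A) - h A) \<longlongrightarrow> 0) F"
      using F(3) by (rule tendsto_mono[rotated])
    moreover have "((\<lambda>h. h (g -` A) - h A) \<longlongrightarrow> L (g -` A) - L A) F"
      by (intro tendsto_intros lim)
    ultimately show ?thesis using tendsto_unique[OF F(1)] by fastforce
  qed
  ultimately show ?thesis using that[of L] const[OF aU] unfolding modular_def by blast
qed

lemma modular_Un_le: "modular m \<Longrightarrow> m (A \<union> B) \<le> m A + m B"
  using submodular_nonneg[OF modular_imp_submodular, of m "A \<inter> B"] unfolding modular_def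
  by (smt (verit))

lemma modular_UN_le: "finite I \<Longrightarrow> modular m \<Longrightarrow> m (\<Union>i\<in>I. A i) \<le> (\<Sum>i\<in>I. m (A i))"
proof (induction I rule: finite_induct)
  case empty
  then show ?case by (simp add: modular_def)
next
  case (insert i I)
  then show ?case using modular_Un_le[of m "A i" "\<Union>i\<in>I. A i"] by simp
qed

lemma modular_disjoint_Un: "modular m \<Longrightarrow> A \<inter> B = {} \<Longrightarrow> m (A \<union> B) = m A + m B"
  unfolding modular_def by (metis add.right_neutral)

section \<open>Borel sets of metrizable spaces and regularity\<close>

text \<open>
  Besides \<open>U = \<Union>D m\<close>, already the interiors of the closed sets \<open>D m\<close> cover \<open>U\<close>. So a closed set
  \<open>C \<subseteq> U\<close> leaves behind \<^emph>\<open>closed\<close> remainders \<open>C - interior (D m)\<close> decreasing to the empty set, to which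
  continuity along closed sets applies. \<open>D m\<close> consists of the points at distance at least
  \<open>1/(m+1)\<close> from the complement of \<open>U\<close>.
\<close>

lemma metrizable_open_exhaustion:
  assumes Y: "metrizable_space Y" and U: "openin Y U"
  obtains D :: "nat \<Rightarrow> 'a set" where "\<And>m. closedin Y (D m)" "incseq D" "\<And>m. D m \<subseteq> U"
    "(\<Union>m. Y interior_of D m) = U"
proof -
  obtain M d where M: "Metric_space M d" and Yeq: "Y = Metric_space.mtopology M d"
    using Y unfolding metrizable_space_def by blast
  interpret Metric_space M d by fact
  define D where "D m = M - (\<Union>z\<in>M - U. mball z (1 / Suc m))" for m
  have UM: "U \<subseteq> M" using U Yeq openin_mtopology by blast
  show thesis
  proof
    show "closedin Y (D m)" for m
      unfolding D_def Yeq by (intro closedin_diff openin_Union) auto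
    show "incseq D"
    proof (rule incseq_SucI)
      fix m
      have "1 / real (Suc (Suc m)) \<le> 1 / real (Suc m)" by (simp add: frac_le)
      then show "D m \<subseteq> D (Suc m)"
        unfolding D_def by (intro Diff_mono UN_mono mball_subset_concentric) auto
    qed
    show sub: "D m \<subseteq> U" for m
      unfolding D_def by auto
    show "(\<Union>m. Y interior_of D m) = U"
    proof
      show "(\<Union>m. Y interior_of D m) \<subseteq> U" using sub interior_of_subset by fastforce
      show "U \<subseteq> (\<Union>m. Y interior_of D m)"
      proof
        fix y assume "y \<in> U"
        then obtain r where r: "r > 0" "mball y r \<subseteq> U"
          using U Yeq openin_mtopology by blast
        obtain m where m: "1 / Suc m < r / 2"
          using nat_approx_posE[of "r / 2"] r by auto
        have "mball y (r / 2) \<subseteq> D m"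
        proof
          fix x assume x: "x \<in> mball y (r / 2)"
          have "x \<notin> mball z (1 / Suc m)" if "z \<in> M - U" for z
          proof
            assume "x \<in> mball z (1 / Suc m)"
            then have "d y z < r"
              using x triangle[of y x z] commute[of z x] m that by auto
            then show False using that r x by auto
          qed
          then show "x \<in> D m" using x by (auto simp: D_def)
        qed
        moreover have "y \<in> mball y (r / 2)" "openin Y (mball y (r / 2))"
          using r \<open>y \<in> U\<close> UM Yeq by auto
        ultimately show "y \<in> (\<Union>m. Y interior_of D m)"
          by (meson UNIV_I UN_I interior_of_maximal subsetD)
      qed
    qed
  qed
qed

lemma open_measurable_borel_of: "openin Y U \<Longrightarrow> U \<in> sets (borel_of Y)"
  by (auto simp: sets_borel_of)

lemma closed_measurable_borel_of:
  assumes "closedin Y C" shows "C \<in> sets (borel_of Y)"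
proof -
  have "topspace Y - (topspace Y - C) \<in> sets (borel_of Y)"
    using assms open_measurable_borel_of[of Y "topspace Y - C"] sets.compl_sets[of _ "borel_of Y"]
    by (simp add: closedin_def space_borel_of)
  then show ?thesis using closedin_subset[OF assms] by (simp add: double_diff)
qed

text \<open>
  The sets that can be squeezed between a closed and an open set form a \<open>\<sigma>\<close>-algebra. A countable union
  of closed sets is not closed, so in the union step only finitely many are kept, by continuity
  from above.
\<close>

lemma finite_borel_measure_regular:
  assumes Y: "metrizable_space Y" and N: "finite_measure N" and sets: "sets N = sets (borel_of Y)"
    and B: "B \<in> sets N" and e: "0 < (e::real)"
  shows "\<exists>C U. closedin Y C \<and> openin Y U \<and> C \<subseteq> B \<and> B \<subseteq> U \<and> measure N (U - C) < e"
proof -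
  interpret finite_measure N by fact
  have op: "openin Y U \<Longrightarrow> U \<in> sets N" and cl: "closedin Y U \<Longrightarrow> U \<in> sets N" for U
    using open_measurable_borel_of closed_measurable_borel_of sets by auto
  have "B \<in> sigma_sets (topspace Y) {U. openin Y U}" using B sets by (simp add: sets_borel_of)
  then show ?thesis using e
  proof (induction arbitrary: e)
    case (Basic U)
    then have U: "openin Y U" by simp
    obtain D where D: "\<And>m. closedin Y (D m)" "incseq D" "\<And>m. D m \<subseteq> U" "(\<Union>m. Y interior_of D m) = U"
      using metrizable_open_exhaustion[OF Y U] by metis
    have "U \<subseteq> (\<Union>m. D m)"
    proof
      fix y assume "y \<in> U"
      then obtain m where "y \<in> Y interior_of D m" using D(4) by blast
      then show "y \<in> (\<Union>m. D m)" using interior_of_subset[of Y "D m"] by blast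
    qed
    then have empty: "(\<Inter>m. U - D m) = {}" by blast
    have "(\<lambda>m. measure N (U - D m)) \<longlonglongrightarrow> measure N (\<Inter>m. U - D m)"
    proof (rule finite_Lim_measure_decseq)
      show "range (\<lambda>m. U - D m) \<subseteq> sets N" using op[OF U] cl[OF D(1)] by blast
      show "decseq (\<lambda>m. U - D m)" using D(2) unfolding incseq_def decseq_def by blast
    qed
    then have "(\<lambda>m. measure N (U - D m)) \<longlonglongrightarrow> 0" unfolding empty measure_empty .
    then have "\<forall>\<^sub>F m in sequentially. measure N (U - D m) < e"
      using Basic by (intro order_tendstoD)
    then obtain m where "measure N (U - D m) < e" by (auto simp: eventually_sequentially)
    then show ?case using D U by blast
  next
    case Empty
    then show ?case by (intro exI[of _ "{}"]) simp
  next
    case (Compl B)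
    from Compl.IH[OF Compl.prems] obtain C U where CU: "closedin Y C" "openin Y U" "C \<subseteq> B" "B \<subseteq> U"
      "measure N (U - C) < e" by blast
    have "(topspace Y - C) - (topspace Y - U) = U - C"
      using openin_subset[OF CU(2)] by auto
    moreover have "closedin Y (topspace Y - U)" "openin Y (topspace Y - C)"
      using CU(1,2) by (auto intro: closedin_diff openin_diff)
    ultimately show ?case
      using CU(3-5) by (intro exI[of _ "topspace Y - U"] exI[of _ "topspace Y - C"]) (simp add: Diff_mono)
  next
    case (Union B)
    define \<delta> where "\<delta> n = e / 2 * (1/2) ^ Suc n" for n :: nat
    have "\<delta> n > 0" for n using Union by (simp add: \<delta>_def)
    then have "\<exists>C U. closedin Y C \<and> openin Y U \<and> C \<subseteq> B n \<and> B n \<subseteq> U \<and> measure N (U - C) < \<delta> n" for n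
      by (rule Union.IH)
    then obtain C U where CU: "\<And>n. closedin Y (C n)" "\<And>n. openin Y (U n)" "\<And>n. C n \<subseteq> B n" "\<And>n. B n \<subseteq> U n"
      "\<And>n. measure N (U n - C n) < \<delta> n" by metis
    have \<delta>: "\<delta> sums (e / 2)"
      unfolding \<delta>_def using sums_mult[OF power_half_series, of "e / 2"] by simp
    define V where "V = (\<Union>n. U n)"
    have V: "openin Y V" unfolding V_def using CU by blast
    define F where "F k = (\<Union>n<k. C n)" for k :: nat
    have F: "closedin Y (F k)" for k
      unfolding F_def using CU by (intro closedin_Union) auto
    have summ: "summable (\<lambda>n. measure N (U n - C n))"
      using sums_summable[OF \<delta>] CU(5) by (rule_tac summable_comparison_test') (auto intro: less_imp_le)
    have "measure N (V - (\<Union>n. C n)) \<le> measure N (\<Union>n. U n - C n)"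
      using CU op cl unfolding V_def by (intro finite_measure_mono) (auto intro!: sets.countable_UN)
    also have "\<dots> \<le> (\<Sum>n. measure N (U n - C n))"
      using CU op cl summ by (intro finite_measure_subadditive_countably) auto
    also have "\<dots> \<le> (\<Sum>n. \<delta> n)"
      using CU(5) summ sums_summable[OF \<delta>] by (intro suminf_le) (auto intro: less_imp_le)
    also have "\<dots> < e" using \<delta> Union.prems by (simp add: sums_unique[symmetric])
    finally have lt: "measure N (V - (\<Union>n. C n)) < e" .
    have "(\<lambda>k. measure N (V - F k)) \<longlonglongrightarrow> measure N (\<Inter>k. V - F k)"
    proof (rule finite_Lim_measure_decseq)
      show "range (\<lambda>k. V - F k) \<subseteq> sets N" using V F op cl by auto
      show "decseq (\<lambda>k. V - F k)" unfolding decseq_def F_def by fastforce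
    qed
    moreover have "(\<Inter>k. V - F k) = V - (\<Union>n. C n)" by (auto simp: F_def)
    ultimately have "\<forall>\<^sub>F k in sequentially. measure N (V - F k) < e"
      using lt by (intro order_tendstoD) auto
    then obtain k where "measure N (V - F k) < e" by (auto simp: eventually_sequentially)
    moreover have "F k \<subseteq> (\<Union>n. B n)" "(\<Union>n. B n) \<subseteq> V"
      using CU(3,4) unfolding F_def V_def by blast+
    ultimately show ?case
      using V F by (intro exI[of _ "F k"] exI[of _ V] conjI)
  qed
qed

lemma closed_inner_regular:
  assumes Y: "metrizable_space Y" and N: "finite_measure N" and sets: "sets N = sets (borel_of Y)"
    and B: "B \<in> sets N" and e: "0 < (e::real)"
  obtains C where "closedin Y C" "C \<subseteq> B" "measure N B < measure N C + e"
proof -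
  interpret finite_measure N by fact
  obtain C U where CU: "closedin Y C" "openin Y U" "C \<subseteq> B" "B \<subseteq> U" "measure N (U - C) < e"
    using finite_borel_measure_regular[OF assms] by blast
  have [measurable]: "C \<in> sets N" "U \<in> sets N"
    using CU sets closed_measurable_borel_of open_measurable_borel_of by auto
  have "measure N B \<le> measure N (C \<union> (U - C))"
    using CU by (intro finite_measure_mono) auto
  also have "\<dots> \<le> measure N C + measure N (U - C)"
    by (intro measure_Un_le) auto
  finally show thesis using CU that by fastforce
qed

text \<open>
  Passing to complements reverses the inequality.
\<close>

lemma prob_space_eqI_le:
  assumes M: "prob_space M" and N: "prob_space N" and sets: "sets M = sets N"
    and le: "\<And>A. A \<in> sets N \<Longrightarrow> measure M A \<le> measure N A"
  shows "M = N"
proof (rule measure_eqI)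
  interpret M: prob_space M by fact
  interpret N: prob_space N by fact
  have sp: "space M = space N" using sets by (rule sets_eq_imp_space_eq)
  fix A assume A: "A \<in> sets M"
  then have "measure M (space M - A) \<le> measure N (space N - A)"
    using le[of "space N - A"] sets sp by auto
  then have "measure N A \<le> measure M A"
    using A sets by (simp add: M.prob_compl N.prob_compl)
  with le[of A] A sets show "emeasure M A = emeasure N A"
    by (simp add: M.emeasure_eq_measure N.emeasure_eq_measure)
qed (fact sets)

section \<open>Images of closed sets under Borel maps\<close>

text \<open>
  A web assigns to every choice function \<open>k\<close> the sequence of sets \<open>V n (k n)\<close>. Their finite
  intersections play the role of neighbourhoods of a compact set: the cover property makes it
  possible to choose \<open>k\<close> losing arbitrarily little outer measure.
\<close>

definition web :: "'a topology \<Rightarrow> (nat \<Rightarrow> nat \<Rightarrow> 'a set) \<Rightarrow> bool" where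
  "web Y V \<longleftrightarrow> (\<forall>n. incseq (V n) \<and> (\<Union>k. V n k) = topspace Y)"

text \<open>
  For a point \<open>y\<close> and a sequence \<open>z\<close> converging to it inside the branch \<open>k\<close>, membership in \<open>E\<close> must
  pass to the limit and back; in effect \<open>E\<close> becomes clopen along branches. This plays the role of the
  classical refinement of a Polish topology that makes a given Borel set clopen. The product of
  countably many refinements becomes the interleaving of webs.
\<close>

definition decides :: "'a topology \<Rightarrow> (nat \<Rightarrow> nat \<Rightarrow> 'a set) \<Rightarrow> 'a set \<Rightarrow> bool" where
  "decides Y V E \<longleftrightarrow>
     (\<forall>k z y. limitin Y z y sequentially \<longrightarrow> (\<forall>n. \<forall>\<^sub>F i in sequentially. z i \<in> V n (k n)) \<longrightarrow>
        (\<forall>\<^sub>F i in sequentially. z i \<in> E \<longleftrightarrow> y \<in> E))"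

definition interleave :: "(nat \<Rightarrow> nat \<Rightarrow> nat \<Rightarrow> 'a set) \<Rightarrow> nat \<Rightarrow> nat \<Rightarrow> 'a set" where
  "interleave V n = (case prod_decode n of (i, j) \<Rightarrow> V i j)"

lemma web_interleave: "(\<And>i. web Y (V i)) \<Longrightarrow> web Y (interleave V)"
  by (auto simp: web_def interleave_def split: prod.split)

lemma interleave_prod_encode: "interleave V (prod_encode (i, j)) = V i j"
  by (simp add: interleave_def)

lemma decides_interleave: "decides Y (V i) E \<Longrightarrow> decides Y (interleave V) E"
  unfolding decides_def
proof safe
  fix k z y
  assume *: "\<forall>k z y. limitin Y z y sequentially \<longrightarrow> (\<forall>n. \<forall>\<^sub>F j in sequentially. z j \<in> V i n (k n)) \<longrightarrow>
        (\<forall>\<^sub>F j in sequentially. z j \<in> E \<longleftrightarrow> y \<in> E)"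
    and lim: "limitin Y z y sequentially" and z: "\<forall>n. \<forall>\<^sub>F j in sequentially. z j \<in> interleave V n (k n)"
  have "\<forall>\<^sub>F j in sequentially. z j \<in> V i n (k (prod_encode (i, n)))" for n
    using z[rule_format, of "prod_encode (i, n)"] by (simp add: interleave_prod_encode)
  then show "\<forall>\<^sub>F j in sequentially. z j \<in> E \<longleftrightarrow> y \<in> E"
    using *[rule_format, OF lim, of "\<lambda>n. k (prod_encode (i, n))"] by blast
qed

lemma limitin_eventually_openin: "limitin Y z y F \<Longrightarrow> openin Y U \<Longrightarrow> y \<in> U \<Longrightarrow> \<forall>\<^sub>F i in F. z i \<in> U"
  by (simp add: limitin_def)

lemma limitin_eventually_topspace: "limitin Y z y F \<Longrightarrow> \<forall>\<^sub>F i in F. z i \<in> topspace Y"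
  by (simp add: limitin_def)

text \<open>
  Sequences outside \<open>U\<close> cannot converge into \<open>U\<close>. The reverse, a sequence in \<open>U\<close> converging to a point
  outside, is excluded by the web: its \<open>k\<close>-th member meets \<open>U\<close> in a closed set.
\<close>

lemma open_decided:
  assumes Y: "metrizable_space Y" and U: "openin Y U"
  shows "\<exists>V. web Y V \<and> decides Y V U"
proof -
  obtain D where D: "\<And>m. closedin Y (D m)" "incseq D" "\<And>m. D m \<subseteq> U" "(\<Union>m. Y interior_of D m) = U"
    using metrizable_open_exhaustion[OF Y U] by metis
  have UD: "(\<Union>m. D m) = U" using D(3,4) interior_of_subset by fastforce
  define V where "V = (\<lambda>n::nat. \<lambda>k. (topspace Y - U) \<union> D k)"
  have "incseq (V n)" for n
    using D(2) unfolding V_def incseq_def by blast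
  moreover have "(\<Union>k. V n k) = topspace Y" for n
    using UD openin_subset[OF U] by (auto simp: V_def)
  ultimately have "web Y V" by (simp add: web_def)
  moreover have "decides Y V U"
    unfolding decides_def
  proof safe
    fix k :: "nat \<Rightarrow> nat" and z y
    assume lim: "limitin Y z y sequentially" and z: "\<forall>n. \<forall>\<^sub>F i in sequentially. z i \<in> V n (k n)"
    show "\<forall>\<^sub>F i in sequentially. z i \<in> U \<longleftrightarrow> y \<in> U"
    proof (cases "y \<in> U")
      case True
      then show ?thesis
        using limitin_eventually_openin[OF lim U] by simp
    next
      case False
      then have "y \<in> topspace Y - D (k 0)"
        using D(3) lim by (auto simp: limitin_def)
      then have "\<forall>\<^sub>F i in sequentially. z i \<in> topspace Y - D (k 0)"
        using limitin_eventually_openin[OF lim] D(1) by blast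
      with z[rule_format, of 0] show ?thesis
        by eventually_elim (use False in \<open>auto simp: V_def\<close>)
    qed
  qed
  ultimately show ?thesis by blast
qed

text \<open>
  Induction over the Borel sets. For a countable union, the webs of the members are interleaved with
  one extra cover \<open>C\<close>: without it a sequence could visit \<open>E 0, E 1, E 2, \<dots>\<close> in turn and leave the
  union in the limit. Inside \<open>C l\<close> the union coincides with \<open>E 0 \<union> \<dots> \<union> E l\<close>.
\<close>

lemma borel_decided:
  assumes Y: "metrizable_space Y" and E: "E \<in> sets (borel_of Y)"
  shows "\<exists>V. web Y V \<and> decides Y V E"
proof -
  have "E \<in> sigma_sets (topspace Y) {U. openin Y U}" using E by (simp add: sets_borel_of)
  then show ?thesis
  proof induction
    case (Basic U)
    then show ?case using open_decided[OF Y] by blast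
  next
    case Empty
    show ?case using open_decided[OF Y openin_empty] .
  next
    case (Compl E)
    then obtain V where V: "web Y V" "decides Y V E" by blast
    have "decides Y V (topspace Y - E)"
      unfolding decides_def
    proof safe
      fix k z y
      assume lim: "limitin Y z y sequentially" and z: "\<forall>n. \<forall>\<^sub>F i in sequentially. z i \<in> V n (k n)"
      then have "\<forall>\<^sub>F i in sequentially. z i \<in> E \<longleftrightarrow> y \<in> E"
        using V(2) unfolding decides_def by blast
      moreover have "\<forall>\<^sub>F i in sequentially. z i \<in> topspace Y"
        using lim by (rule limitin_eventually_topspace)
      ultimately show "\<forall>\<^sub>F i in sequentially. z i \<in> topspace Y - E \<longleftrightarrow> y \<in> topspace Y - E"
        by eventually_elim (use lim in \<open>auto simp: limitin_def\<close>)
    qed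
    with V show ?case by blast
  next
    case (Union E)
    then obtain V where V: "\<And>i. web Y (V i)" "\<And>i. decides Y (V i) (E i)" by metis
    have E: "E i \<subseteq> topspace Y" for i
      using Union.hyps[of i] sigma_sets_into_sp[of "{U. openin Y U}" "topspace Y"]
      by (auto dest: openin_subset)
    define C where "C k = (topspace Y - (\<Union>i. E i)) \<union> (\<Union>i\<le>k. E i)" for k
    define W where "W = interleave (\<lambda>i. case i of 0 \<Rightarrow> (\<lambda>_. C) | Suc i \<Rightarrow> V i)"
    have "incseq C" unfolding C_def by (intro monoI) fastforce
    moreover have "(\<Union>k. C k) = topspace Y" using E by (auto simp: C_def)
    ultimately have "web Y W"
      unfolding W_def using V(1) by (intro web_interleave) (simp add: web_def split: nat.split)
    moreover have dec: "decides Y W (E i)" for i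
      unfolding W_def by (rule decides_interleave[of _ _ "Suc i"]) (simp add: V)
    have "decides Y W (\<Union>i. E i)"
      unfolding decides_def
    proof safe
      fix k z y
      assume lim: "limitin Y z y sequentially" and z: "\<forall>n. \<forall>\<^sub>F i in sequentially. z i \<in> W n (k n)"
      have ev: "\<forall>\<^sub>F i in sequentially. z i \<in> E j \<longleftrightarrow> y \<in> E j" for j
        using dec lim z unfolding decides_def by blast
      show "\<forall>\<^sub>F i in sequentially. z i \<in> (\<Union>i. E i) \<longleftrightarrow> y \<in> (\<Union>i. E i)"
      proof (cases "y \<in> (\<Union>i. E i)")
        case True
        then obtain j where j: "y \<in> E j" by blast
        from ev[of j] show ?thesis by eventually_elim (use j in auto)
      next
        case False
        define l where "l = k (prod_encode (0, 0))"
        have "\<forall>\<^sub>F i in sequentially. z i \<in> C l"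
          using z[rule_format, of "prod_encode (0, 0)"]
          by (simp add: W_def interleave_prod_encode l_def)
        moreover have "\<forall>\<^sub>F i in sequentially. \<forall>j\<in>{..l}. z i \<in> E j \<longleftrightarrow> y \<in> E j"
          by (rule eventually_ball_finite) (use ev in auto)
        ultimately show ?thesis
          by eventually_elim (use False in \<open>auto simp: C_def\<close>)
      qed
    qed
    ultimately show ?case by blast
  qed
qed

text \<open>
  Stage \<open>n\<close> consists of finite unions of balls of radius \<open>1/(n+1)\<close> around a dense sequence, so a
  sequence that eventually stays in one member of every stage is totally bounded.
\<close>

lemma precompact_web:
  assumes cm: "completely_metrizable_space Y" and sep: "separable_topology Y"
  obtains V where "web Y V"
    "\<And>k z. (\<And>n. \<forall>\<^sub>F i in sequentially. z i \<in> V n (k n)) \<Longrightarrow> (\<And>i. z i \<in> topspace Y)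
       \<Longrightarrow> \<exists>r y. strict_mono (r :: nat \<Rightarrow> nat) \<and> limitin Y (z \<circ> r) y sequentially"
proof -
  obtain M d where M: "Metric_space M d" and cpl: "Metric_space.mcomplete M d" 
    and Yeq: "Y = Metric_space.mtopology M d"
    using cm unfolding completely_metrizable_space_def by blast
  interpret Metric_space M d by fact
  have tY: "topspace Y = M" by (simp add: Yeq)
  obtain D where D: "countable D" "D \<subseteq> M" "Y closure_of D = M"
    using sep tY unfolding separable_topology_def by auto
  show thesis
  proof (cases "D = {}")
    case True
    then have "M = {}" using D by simp
    then show thesis by (intro that[of "\<lambda>_ _. {}"]) (auto simp: web_def tY incseq_def)
  next
    case False
    define a where "a = from_nat_into D"
    have a: "range a = D" using D False by (simp add: a_def)
    have dense: "\<exists>i. x \<in> mball (a i) e" if "x \<in> M" "e > 0" for x e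
    proof -
      have "x \<in> Y closure_of D" using D that by simp
      moreover have "openin Y (mball x e)" "x \<in> mball x e" using that Yeq by auto
      ultimately obtain w where "w \<in> D" "w \<in> mball x e"
        unfolding in_closure_of by blast
      then show ?thesis using a by (metis in_mball commute imageE)
    qed
    define V where "V n k = (\<Union>i\<le>k. mball (a i) (1 / Suc n))" for n k :: nat
    show thesis
    proof
      have "incseq (V n)" for n
        unfolding V_def by (intro monoI UN_mono) auto
      moreover have "(\<Union>k. V n k) = topspace Y" for n
        using dense[of _ "1 / Suc n"] unfolding V_def tY by fastforce
      ultimately show "web Y V" by (simp add: web_def)
    next
      fix k z
      assume z: "\<And>n. \<forall>\<^sub>F i in sequentially. z i \<in> V n (k n)" and zY: "\<And>i::nat. z i \<in> topspace Y"
      have "mtotally_bounded (range z)"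
        unfolding mtotally_bounded_def
      proof (intro allI impI)
        fix e :: real assume "e > 0"
        obtain n where n: "1 / Suc n < e / 2"
          using nat_approx_posE[of "e / 2"] \<open>e > 0\<close> by auto
        obtain N where N: "\<And>i. i \<ge> N \<Longrightarrow> z i \<in> V n (k n)"
          using z[of n] unfolding eventually_sequentially by blast
        define J where "J = {j. j \<le> k n \<and> (\<exists>i. z i \<in> mball (a j) (1 / Suc n))}"
        have "\<forall>j\<in>J. \<exists>i. z i \<in> mball (a j) (1 / Suc n)" by (auto simp: J_def)
        then obtain w where w: "\<And>j. j \<in> J \<Longrightarrow> z (w j) \<in> mball (a j) (1 / Suc n)" by metis
        have "z i \<in> (\<Union>x\<in>z ` (w ` J \<union> {..<N}). mball x e)" for i
        proof (cases "i < N")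
          case True
          moreover have "z i \<in> mball (z i) e" using zY tY \<open>e > 0\<close> by auto
          ultimately show ?thesis by blast
        next
          case False
          then obtain j where j: "j \<le> k n" "z i \<in> mball (a j) (1 / Suc n)"
            using N[of i] by (auto simp: V_def)
          then have "j \<in> J" by (auto simp: J_def)
          have "d (z (w j)) (z i) < e"
            using w[OF \<open>j \<in> J\<close>] j n triangle[of "z (w j)" "a j" "z i"] commute[of "a j" "z (w j)"]
            by auto
          then have "z i \<in> mball (z (w j)) e" using zY tY by auto
          then show ?thesis using \<open>j \<in> J\<close> by blast
        qed
        moreover have "finite (z ` (w ` J \<union> {..<N}))" by (simp add: J_def)
        ultimately show "\<exists>K. finite K \<and> K \<subseteq> range z \<and> range z \<subseteq> (\<Union>x\<in>K. mball x e)"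
          by (intro exI[of _ "z ` (w ` J \<union> {..<N})"]) blast
      qed
      then obtain r where r: "strict_mono r" "MCauchy (z \<circ> r)"
        unfolding mtotally_bounded_sequentially by blast
      then show "\<exists>r y. strict_mono (r :: nat \<Rightarrow> nat) \<and> limitin Y (z \<circ> r) y sequentially"
        using cpl unfolding mcomplete_def Yeq by blast
    qed
  qed
qed

lemma (in finite_measure) completion_sets_if_inner_approx:
  assumes A: "A \<subseteq> space M"
    and inner: "\<And>t. t < outer_measure_of M A \<Longrightarrow> \<exists>H\<in>sets M. H \<subseteq> A \<and> t \<le> emeasure M H"
  shows "A \<in> sets (completion M)"
proof -
  let ?\<H> = "{H \<in> sets M. H \<subseteq> A}"
  have ne: "?\<H> \<noteq> {}" by blast
  obtain f :: "nat \<Rightarrow> ennreal" where f: "range f \<subseteq> emeasure M ` ?\<H>"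
      "Sup (emeasure M ` ?\<H>) = Sup (range f)"
    using ennreal_SUP_countable_SUP[OF ne, of "emeasure M"] by blast
  then have "\<forall>n. \<exists>H. H \<in> sets M \<and> H \<subseteq> A \<and> f n = emeasure M H" by blast
  then obtain H where H: "\<And>n. H n \<in> sets M" "\<And>n. H n \<subseteq> A" "\<And>n. f n = emeasure M (H n)"
    by metis
  obtain E where E: "E \<in> sets M" "A \<subseteq> E" "outer_measure_of M A = emeasure M E"
    using outer_measure_of_attain[OF A] by blast
  have "outer_measure_of M A \<le> Sup (emeasure M ` ?\<H>)"
  proof (rule dense_le)
    fix t assume "t < outer_measure_of M A"
    then obtain H where "H \<in> ?\<H>" "t \<le> emeasure M H" using inner by blast
    then show "t \<le> Sup (emeasure M ` ?\<H>)" by (rule SUP_upper2)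
  qed
  also have "\<dots> = (SUP n. emeasure M (H n))" using f H by simp
  also have "\<dots> \<le> emeasure M (\<Union>n. H n)"
    using H by (intro SUP_least emeasure_mono) auto
  finally have "emeasure M E \<le> emeasure M (\<Union>n. H n)" using E by simp
  moreover have "emeasure M (\<Union>n. H n) \<le> emeasure M E"
    using H(2) E by (intro emeasure_mono) blast+
  ultimately have eq: "emeasure M (\<Union>n. H n) = emeasure M E" by simp
  show ?thesis
  proof (rule completion.complete_sets_sandwich)
    show "(\<Union>n. H n) \<in> sets (completion M)" "E \<in> sets (completion M)" using H E by auto
    show "(\<Union>n. H n) \<subseteq> A" "A \<subseteq> E" using H E by auto
    show "emeasure (completion M) (\<Union>n. H n) = emeasure (completion M) E"
      "emeasure (completion M) (\<Union>n. H n) < \<infinity>"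
      using eq H E emeasure_finite[of E] by (auto simp: less_top[symmetric])
  qed
qed

text \<open>
  The capacity argument for analytic sets, with webs in place of continuity. Given \<open>t\<close> below the outer
  measure of \<open>p(C)\<close>, a branch \<open>k\<close> is chosen stage by stage such that the decreasing sets
  \<open>Q n \<subseteq> C\<close> keep \<open>p (Q n)\<close> of outer measure above \<open>t\<close>; only continuity of outer measures along
  increasing sequences is used. The images \<open>p (Q n)\<close> are enlarged to measurable sets \<open>H n\<close> by
  looking only at the first \<open>n\<close> of the separating sets. The web guarantees that the enlargement does
  no harm in the limit: \<open>\<Inter>H n \<subseteq> p(C)\<close>.
\<close>

lemma borel_image_closed_completion_measurable:
  assumes M: "finite_measure M"
    and \<A>: "\<And>i. A i \<in> sets M"
    and separating: "\<And>x y. x \<in> space M \<Longrightarrow> y \<in> space M \<Longrightarrow> (\<And>i. x \<in> A i \<longleftrightarrow> y \<in> A (i::nat)) \<Longrightarrow> x = y"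
    and Y: "polish_topology Y" and p: "p \<in> measurable (borel_of Y) M" and C: "closedin Y C"
  shows "p ` C \<in> sets (completion M)"
proof -
  interpret finite_measure M by fact
  have cm: "completely_metrizable_space Y" and sep: "separable_topology Y"
    using Y by (auto simp: polish_topology_def)
  then have metr: "metrizable_space Y" by (simp add: completely_metrizable_imp_metrizable_space)
  have CY: "C \<subseteq> topspace Y" using C by (rule closedin_subset)
  have pY: "p y \<in> space M" if "y \<in> topspace Y" for y
    using measurable_space[OF p] that by (simp add: space_borel_of)
  obtain V0 where V0: "web Y V0"
    and precompact: "\<And>k z. (\<And>n. \<forall>\<^sub>F i in sequentially. z i \<in> V0 n (k n)) \<Longrightarrow> (\<And>i. z i \<in> topspace Y)
       \<Longrightarrow> \<exists>r y. strict_mono (r :: nat \<Rightarrow> nat) \<and> limitin Y (z \<circ> r) y sequentially"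
    using precompact_web[OF cm sep] by metis
  have "\<exists>V. web Y V \<and> decides Y V (p -` A i \<inter> topspace Y)" for i
    using measurable_sets[OF p \<A>] by (intro borel_decided[OF metr]) (simp add: space_borel_of)
  then obtain V1 where V1: "\<And>i. web Y (V1 i)" "\<And>i. decides Y (V1 i) (p -` A i \<inter> topspace Y)" by metis
  \<comment> \<open>This web provides limit points and decides all the sets \<open>p\<inverse>(A i)\<close>.\<close>
  define V where "V = interleave (\<lambda>i. case i of 0 \<Rightarrow> V0 | Suc i \<Rightarrow> V1 i)"
  have web: "web Y V"
    unfolding V_def using V0 V1 by (intro web_interleave) (simp split: nat.split)
  have dec: "decides Y V (p -` A i \<inter> topspace Y)" for i
    unfolding V_def by (rule decides_interleave[of _ _ "Suc i"]) (simp add: V1)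
  show ?thesis
  proof (rule completion_sets_if_inner_approx)
    show "p ` C \<subseteq> space M" using pY CY by blast
    fix t assume t: "t < outer_measure_of M (p ` C)"
    define P where "P = (\<lambda>Q. Q \<subseteq> C \<and> t < outer_measure_of M (p ` Q))"
    have step: "\<exists>Q'. P Q' \<and> (\<exists>k. Q' = Q \<inter> V n k)" if "P Q" for Q n
    proof -
      have QC: "Q \<subseteq> C" and tQ: "t < outer_measure_of M (p ` Q)" using that by (auto simp: P_def)
      have "(\<Union>k. Q \<inter> V n k) = Q" using web QC CY by (auto simp: web_def)
      then have "p ` Q = (\<Union>k. p ` (Q \<inter> V n k))" by (metis image_UN)
      moreover have "(SUP k. outer_measure_of M (p ` (Q \<inter> V n k))) = outer_measure_of M (\<Union>k. p ` (Q \<inter> V n k))"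
      proof (rule SUP_outer_measure_of_incseq)
        show "p ` (Q \<inter> V n k) \<subseteq> space M" for k using pY QC CY by blast
        have "incseq (V n)" using web by (simp add: web_def)
        then show "incseq (\<lambda>k. p ` (Q \<inter> V n k))"
          unfolding incseq_def by blast
      qed
      ultimately have "t < (SUP k. outer_measure_of M (p ` (Q \<inter> V n k)))" using tQ by simp
      then obtain k where "t < outer_measure_of M (p ` (Q \<inter> V n k))" unfolding less_SUP_iff by blast
      then show ?thesis using QC by (intro exI[of _ "Q \<inter> V n k"]) (auto simp: P_def)
    qed
    have "\<exists>Q. \<forall>n. P (Q n) \<and> (\<exists>k. Q (Suc n) = Q n \<inter> V n k)"
    proof (rule dependent_nat_choice[where P = "\<lambda>_. P" and Q = "\<lambda>n Q Q'. \<exists>k. Q' = Q \<inter> V n k"])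
      show "\<exists>Q. P Q" using t by (auto simp: P_def)
    qed (use step in blast)
    then obtain Q where Q: "\<And>n. P (Q n)" "\<And>n. \<exists>k. Q (Suc n) = Q n \<inter> V n k" by blast
    then obtain k where k: "\<And>n. Q (Suc n) = Q n \<inter> V n (k n)" by metis
    have decQ: "decseq Q" by (rule decseq_SucI) (simp add: k)
    have QV: "Q i \<subseteq> V n (k n)" if "n < i" for i n
      using decseqD[OF decQ, of "Suc n" i] that k by auto
    define H where "H n = {x \<in> space M. \<exists>z\<in>Q n. \<forall>i<n. x \<in> A i \<longleftrightarrow> p z \<in> A i}" for n
    have H_meas: "H n \<in> sets M" for n
    proof -
      have "H n = (\<Union>J\<in>(\<lambda>z. {i. i < n \<and> p z \<in> A i}) ` Q n. {x \<in> space M. \<forall>i<n. x \<in> A i \<longleftrightarrow> i \<in> J})"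
        by (auto simp: H_def)
      also have "\<dots> \<in> sets M"
      proof (rule sets.finite_UN)
        have "(\<lambda>z. {i. i < n \<and> p z \<in> A i}) ` Q n \<subseteq> Pow {..<n}" by auto
        then show "finite ((\<lambda>z. {i. i < n \<and> p z \<in> A i}) ` Q n)" by (rule finite_subset) simp
        show "{x \<in> space M. \<forall>i<n. x \<in> A i \<longleftrightarrow> i \<in> J} \<in> sets M" for J
          using \<A> by measurable
      qed
      finally show ?thesis .
    qed
    have "decseq H"
    proof (rule decseq_SucI)
      fix n
      show "H (Suc n) \<subseteq> H n"
        using k[of n] by (force simp: H_def)
    qed
    have "t \<le> emeasure M (H n)" for n
    proof -
      have "p ` Q n \<subseteq> H n" using Q(1)[of n] pY CY by (auto simp: H_def P_def)
      then have "outer_measure_of M (p ` Q n) \<le> emeasure M (H n)"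
        using outer_measure_of_mono[of "p ` Q n" "H n" M] H_meas by simp
      then show ?thesis using Q(1)[of n] by (auto simp: P_def)
    qed
    moreover have "(\<lambda>n. emeasure M (H n)) \<longlonglongrightarrow> emeasure M (\<Inter>n. H n)"
      using H_meas \<open>decseq H\<close> by (intro Lim_emeasure_decseq) auto
    ultimately have "t \<le> emeasure M (\<Inter>n. H n)"
      by (meson LIMSEQ_le_const)
    moreover have "(\<Inter>n. H n) \<subseteq> p ` C"
    proof
      fix x assume x: "x \<in> (\<Inter>n. H n)"
      then have xM: "x \<in> space M" by (auto simp: H_def)
      have "\<forall>n. \<exists>z. z \<in> Q n \<and> (\<forall>i<n. x \<in> A i \<longleftrightarrow> p z \<in> A i)" using x by (auto simp: H_def)
      then obtain z where z: "\<And>n. z n \<in> Q n" "\<And>n i. i < n \<Longrightarrow> x \<in> A i \<longleftrightarrow> p (z n) \<in> A i" by metis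
      have zC: "z n \<in> C" for n using z(1)[of n] Q(1)[of n] by (auto simp: P_def)
      have zV: "\<forall>\<^sub>F i in sequentially. z i \<in> V n (k n)" for n
        using eventually_gt_at_top[of n] by eventually_elim (use z(1) QV in blast)
      have "\<exists>r y. strict_mono (r :: nat \<Rightarrow> nat) \<and> limitin Y (z \<circ> r) y sequentially"
      proof (rule precompact)
        show "\<forall>\<^sub>F i in sequentially. z i \<in> V0 n ((\<lambda>n. k (prod_encode (0, n))) n)" for n
          using zV[of "prod_encode (0, n)"] by (simp add: V_def interleave_prod_encode)
        show "z i \<in> topspace Y" for i using zC CY by blast
      qed
      \<comment> \<open>The limit point \<open>y\<close> is a preimage of \<open>x\<close>, since no \<open>A j\<close> separates \<open>p y\<close> from \<open>x\<close>.\<close>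
      then obtain r y where r: "strict_mono r" and lim: "limitin Y (z \<circ> r) y sequentially" by blast
      have yC: "y \<in> C"
        using limitin_closedin[OF lim C] zC by simp
      have "x \<in> A j \<longleftrightarrow> p y \<in> A j" for j
      proof -
        have "\<forall>\<^sub>F i in sequentially. (z \<circ> r) i \<in> V n (k n)" for n
          using eventually_subseq[OF r zV] by simp
        then have "\<forall>\<^sub>F i in sequentially. (z \<circ> r) i \<in> p -` A j \<inter> topspace Y \<longleftrightarrow> y \<in> p -` A j \<inter> topspace Y"
          using dec[of j] lim unfolding decides_def by blast
        moreover have "\<forall>\<^sub>F i in sequentially. x \<in> A j \<longleftrightarrow> p (z (r i)) \<in> A j"
        proof (rule eventually_subseq[OF r, of "\<lambda>i. x \<in> A j \<longleftrightarrow> p (z i) \<in> A j"])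
          show "\<forall>\<^sub>F i in sequentially. x \<in> A j \<longleftrightarrow> p (z i) \<in> A j"
            by (rule eventually_mono[OF eventually_gt_at_top[of j]]) (rule z(2))
        qed
        ultimately have "\<forall>\<^sub>F i in sequentially. x \<in> A j \<longleftrightarrow> p y \<in> A j"
          by eventually_elim (use zC CY yC in auto)
        then show ?thesis by simp
      qed
      then have "x = p y"
        using separating[OF xM pY] yC CY by blast
      with yC show "x \<in> p ` C" by blast
    qed
    moreover have "(\<Inter>n. H n) \<in> sets M"
      using H_meas by (intro sets.countable_INT) auto
    ultimately show "\<exists>H\<in>sets M. H \<subseteq> p ` C \<and> t \<le> emeasure M H" by blast
  qed
qed

lemma standard_borel_separating_sequence:
  assumes "standard_borel_space M"
  obtains A :: "nat \<Rightarrow> 'a set" where "\<And>i. A i \<in> sets M"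
    "\<And>x y. x \<in> space M \<Longrightarrow> y \<in> space M \<Longrightarrow> (\<And>i. x \<in> A i \<longleftrightarrow> y \<in> A i) \<Longrightarrow> x = y"
proof -
  obtain \<tau> where \<tau>: "polish_topology \<tau>" "sets (borel_of \<tau>) = sets M"
    using assms by (auto simp: standard_borel_space_def)
  have sp: "topspace \<tau> = space M"
    using sets_eq_imp_space_eq[OF \<tau>(2)] by (simp add: space_borel_of)
  obtain X d where M: "Metric_space X d" and Yeq: "\<tau> = Metric_space.mtopology X d"
    using \<tau>(1) unfolding completely_metrizable_space_def polish_topology_def by blast
  interpret Metric_space X d by fact
  have X: "X = space M" using sp by (simp add: Yeq)
  obtain D where D: "countable D" "D \<subseteq> X" "\<tau> closure_of D = X"
    using \<tau>(1) sp X unfolding polish_topology_def separable_topology_def by auto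
  define \<B> where "\<B> = insert {} ((\<lambda>(a, n). mball a (1 / Suc n)) ` (D \<times> (UNIV :: nat set)))"
  have \<B>: "countable \<B>" "\<B> \<noteq> {}" using D by (auto simp: \<B>_def)
  have "B \<in> sets M" if "B \<in> \<B>" for B
  proof -
    have "openin \<tau> B" using that by (auto simp: \<B>_def Yeq)
    then show ?thesis unfolding \<tau>(2)[symmetric] sets_borel_of by blast
  qed
  moreover have "x = y" if xy: "x \<in> X" "y \<in> X" "\<And>B. B \<in> \<B> \<Longrightarrow> x \<in> B \<longleftrightarrow> y \<in> B" for x y
  proof (rule ccontr)
    assume "x \<noteq> y"
    then have "d x y > 0" using xy by (metis nonneg order_le_less zero)
    then obtain n where n: "1 / Suc n < d x y / 2"
      using nat_approx_posE[of "d x y / 2"] by auto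
    have "x \<in> \<tau> closure_of D" using D xy by simp
    moreover have "openin \<tau> (mball x (1 / Suc n))" "x \<in> mball x (1 / Suc n)" using xy Yeq by auto
    ultimately obtain a where a: "a \<in> D" "a \<in> mball x (1 / Suc n)"
      unfolding in_closure_of by blast
    then have "mball a (1 / Suc n) \<in> \<B>" by (auto simp: \<B>_def)
    moreover have "x \<in> mball a (1 / Suc n)" using a by (auto simp: commute)
    ultimately have "y \<in> mball a (1 / Suc n)" using xy by blast
    then show False using a n xy triangle[of x a y] by auto
  qed
  ultimately have sep: "\<And>B. B \<in> \<B> \<Longrightarrow> B \<in> sets M"
    "\<And>x y. x \<in> space M \<Longrightarrow> y \<in> space M \<Longrightarrow> (\<And>B. B \<in> \<B> \<Longrightarrow> x \<in> B \<longleftrightarrow> y \<in> B) \<Longrightarrow> x = y"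
    unfolding X by blast+
  have range: "range (from_nat_into \<B>) = \<B>" using \<B> by simp
  show thesis
  proof
    show "from_nat_into \<B> i \<in> sets M" for i using sep(1) range by blast
    fix x y
    assume xy: "x \<in> space M" "y \<in> space M" and eq: "\<And>i. x \<in> from_nat_into \<B> i \<longleftrightarrow> y \<in> from_nat_into \<B> i"
    show "x = y"
    proof (rule sep(2)[OF xy])
      fix B assume "B \<in> \<B>"
      then obtain i where "B = from_nat_into \<B> i" using range by blast
      then show "x \<in> B \<longleftrightarrow> y \<in> B" using eq by simp
    qed
  qed
qed

section \<open>The capacity of images\<close>

text \<open>
  Replace both sets by measurable hulls, where equality holds.
\<close>

lemma outer_measure_of_strongly_subadditive:
  assumes "A \<subseteq> space M" "B \<subseteq> space M"
  shows "outer_measure_of M (A \<union> B) + outer_measure_of M (A \<inter> B) \<le> outer_measure_of M A + outer_measure_of M B"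
proof -
  obtain E where E: "E \<in> sets M" "A \<subseteq> E" "outer_measure_of M A = emeasure M E"
    using outer_measure_of_attain[OF assms(1)] by blast
  obtain F where F: "F \<in> sets M" "B \<subseteq> F" "outer_measure_of M B = emeasure M F"
    using outer_measure_of_attain[OF assms(2)] by blast
  have "outer_measure_of M (A \<union> B) \<le> emeasure M (E \<union> F)"
    using outer_measure_of_mono[OF Un_mono[OF E(2) F(2)], of M] E F by simp
  moreover have "outer_measure_of M (A \<inter> B) \<le> emeasure M (E \<inter> F)"
    using outer_measure_of_mono[OF Int_mono[OF E(2) F(2)], of M] E F by simp
  ultimately show ?thesis
    using emeasure_Un_Int[OF E(1) F(1)] E(3) F(3) by (simp add: add_mono)
qed

lemma emeasure_completion_eq_outer_measure_of:
  assumes A: "A \<in> sets (completion M)"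
  shows "emeasure (completion M) A = outer_measure_of M A"
proof (rule antisym)
  obtain B where B: "B \<in> sets M" "A \<subseteq> B" "outer_measure_of M A = emeasure M B"
    using outer_measure_of_attain[of A M] sets.sets_into_space[OF A] by auto
  have "emeasure (completion M) A \<le> emeasure (completion M) B"
    using B by (intro emeasure_mono) auto
  then show "emeasure (completion M) A \<le> outer_measure_of M A" using B by simp
next
  obtain B where B: "B \<in> sets M" "A \<subseteq> B" "emeasure (completion M) A = emeasure M B"
    using completion_upper[OF A] by auto
  then show "outer_measure_of M A \<le> emeasure (completion M) A"
    using outer_measure_of_mono[OF B(2), of M] by simp
qed

lemma outer_measure_of_vimage_le:
  assumes T: "T \<in> measurable (completion M) M"
    and pres: "\<And>A. A \<in> sets M \<Longrightarrow> emeasure (completion M) (T -` A \<inter> space M) = emeasure M A"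
    and A: "A \<subseteq> space M"
  shows "outer_measure_of M (T -` A \<inter> space M) \<le> outer_measure_of M A"
proof -
  obtain B where B: "B \<in> sets M" "A \<subseteq> B" "outer_measure_of M A = emeasure M B"
    using outer_measure_of_attain[OF A] by blast
  have "T -` B \<inter> space M \<in> sets (completion M)"
    using measurable_sets[OF T B(1)] by simp
  then have "outer_measure_of M (T -` B \<inter> space M) = emeasure M B"
    using emeasure_completion_eq_outer_measure_of pres[OF B(1)] by metis
  then show ?thesis
    using outer_measure_of_mono[of "T -` A \<inter> space M" "T -` B \<inter> space M" M] B by fastforce
qed

text \<open>
  The intersection with \<open>D\<close>, the domain on which \<open>p\<close> is controlled, makes this a set function on the
  whole type, so that the lemmas on set functions above apply without relativization. It is real-valued for the
  same reason; for finite \<open>M\<close> no information is lost.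
\<close>

definition image_capacity :: "'a measure \<Rightarrow> ('b \<Rightarrow> 'a) \<Rightarrow> 'b set \<Rightarrow> 'b set \<Rightarrow> real" where
  "image_capacity M p D A = enn2real (outer_measure_of M (p ` (A \<inter> D)))"

context finite_measure
begin

lemma outer_measure_of_finite: "A \<subseteq> space M \<Longrightarrow> outer_measure_of M A < top"
  using outer_measure_of_mono[of A "space M" M] emeasure_finite[of "space M"]
  by (auto simp: top_unique less_top[symmetric])

lemma ennreal_image_capacity:
  "p ` D \<subseteq> space M \<Longrightarrow> ennreal (image_capacity M p D A) = outer_measure_of M (p ` (A \<inter> D))"
  unfolding image_capacity_def
  by (rule ennreal_enn2real[OF outer_measure_of_finite]) blast

lemma submodular_image_capacity:
  assumes p: "p ` D \<subseteq> space M"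
  shows "submodular (image_capacity M p D)"
proof -
  have nonneg: "0 \<le> image_capacity M p D A" for A by (simp add: image_capacity_def)
  note cap = ennreal_image_capacity[OF p]
  have "image_capacity M p D (A \<union> B) + image_capacity M p D (A \<inter> B)
      \<le> image_capacity M p D A + image_capacity M p D B" for A B
  proof -
    have "ennreal (image_capacity M p D (A \<union> B)) + ennreal (image_capacity M p D (A \<inter> B))
        \<le> outer_measure_of M (p ` (A \<inter> D) \<union> p ` (B \<inter> D)) + outer_measure_of M (p ` (A \<inter> D) \<inter> p ` (B \<inter> D))"
      unfolding cap by (intro add_mono outer_measure_of_mono) auto
    also have "\<dots> \<le> outer_measure_of M (p ` (A \<inter> D)) + outer_measure_of M (p ` (B \<inter> D))"
      using p by (intro outer_measure_of_strongly_subadditive) auto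
    finally show ?thesis
      unfolding cap[symmetric] using nonneg by (simp add: ennreal_plus[symmetric] del: ennreal_plus)
  qed
  moreover have "mono (image_capacity M p D)"
  proof (rule monoI)
    fix A B :: "'b set" assume "A \<subseteq> B"
    then have "ennreal (image_capacity M p D A) \<le> ennreal (image_capacity M p D B)"
      unfolding cap by (intro outer_measure_of_mono) auto
    then show "image_capacity M p D A \<le> image_capacity M p D B" using nonneg by simp
  qed
  moreover have "image_capacity M p D {} = 0" by (simp add: image_capacity_def)
  ultimately show ?thesis by (simp add: submodular_def)
qed

text \<open>
  If \<open>x\<close> lies in all \<open>p (C n)\<close>, the closed sets \<open>C n\<close> meet the fibre over \<open>x\<close>; when the fibre is
  compact they meet it in a common point. So \<open>\<Inter>p (C n)\<close> and \<open>p (\<Inter>C n)\<close> differ by a null set only, and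
  measurability of the images gives continuity from above.
\<close>

lemma image_capacity_decseq_closed:
  assumes p: "p ` topspace Y \<subseteq> space M"
    and meas: "\<And>C. closedin Y C \<Longrightarrow> p ` C \<in> sets (completion M)"
    and cpt: "AE x in M. compactin Y {y \<in> topspace Y. p y = x}"
    and C: "\<And>n::nat. closedin Y (C n)" and dec: "decseq C"
  shows "(\<lambda>n. image_capacity M p (topspace Y) (C n)) \<longlonglongrightarrow> image_capacity M p (topspace Y) (\<Inter>n. C n)"
proof -
  interpret cM: finite_measure "completion M"
    by (rule finite_measureI) (use emeasure_finite[of "space M"] in simp)
  obtain N where N: "N \<in> null_sets M" "{x \<in> space M. \<not> compactin Y {y \<in> topspace Y. p y = x}} \<subseteq> N"
    using cpt by (auto simp: eventually_ae_filter)
  have Cint: "closedin Y (\<Inter>n. C n)" using C by blast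
  have sub: "C n \<subseteq> topspace Y" for n using C by (rule closedin_subset)
  have eq: "outer_measure_of M (p ` (A \<inter> topspace Y)) = emeasure (completion M) (p ` A)" if "closedin Y A" for A
    using emeasure_completion_eq_outer_measure_of[OF meas[OF that]] closedin_subset[OF that]
    by (simp add: Int_absorb2)
  have upper: "(\<Inter>n. p ` C n) \<subseteq> p ` (\<Inter>n. C n) \<union> N"
  proof
    fix x assume x: "x \<in> (\<Inter>n. p ` C n)"
    show "x \<in> p ` (\<Inter>n. C n) \<union> N"
    proof (cases "x \<in> N")
      case False
      let ?F = "{y \<in> topspace Y. p y = x}"
      have "x \<in> space M" using x sub p by blast
      then have F: "compactin Y ?F" using N False by blast
      have "(\<Inter>n. C n \<inter> ?F) \<noteq> {}"
      proof (rule compact_space_imp_nest)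
        show "compact_space (subtopology Y ?F)" using F compactin_subspace by blast
        show "closedin (subtopology Y ?F) (C n \<inter> ?F)" for n
          using C closedin_subtopology by blast
        show "C n \<inter> ?F \<noteq> {}" for n using x sub[of n] by blast
        show "decseq (\<lambda>n. C n \<inter> ?F)" using dec unfolding decseq_def by blast
      qed
      then show ?thesis by blast
    qed simp
  qed
  have "emeasure (completion M) (\<Inter>n. p ` C n) = emeasure (completion M) (p ` (\<Inter>n. C n))"
  proof (rule antisym)
    have N': "N \<in> null_sets (completion M)" using N(1) by (rule null_sets_completionI)
    have "emeasure (completion M) (\<Inter>n. p ` C n) \<le> emeasure (completion M) (p ` (\<Inter>n. C n) \<union> N)"
      using upper meas[OF Cint] N' by (intro emeasure_mono) auto
    also have "\<dots> = emeasure (completion M) (p ` (\<Inter>n. C n))"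
      using meas[OF Cint] N' by (rule emeasure_Un_null_set)
    finally show "emeasure (completion M) (\<Inter>n. p ` C n) \<le> emeasure (completion M) (p ` (\<Inter>n. C n))" .
    show "emeasure (completion M) (p ` (\<Inter>n. C n)) \<le> emeasure (completion M) (\<Inter>n. p ` C n)"
      using meas[OF C] by (intro emeasure_mono sets.countable_INT) auto
  qed
  moreover have "(\<lambda>n. emeasure (completion M) (p ` C n)) \<longlonglongrightarrow> emeasure (completion M) (\<Inter>n. p ` C n)"
  proof (rule Lim_emeasure_decseq)
    show "range (\<lambda>n. p ` C n) \<subseteq> sets (completion M)" using meas[OF C] by blast
    show "decseq (\<lambda>n. p ` C n)" using dec unfolding decseq_def by blast
  qed (simp add: cM.emeasure_finite)
  ultimately have "(\<lambda>n. outer_measure_of M (p ` (C n \<inter> topspace Y)))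
      \<longlonglongrightarrow> outer_measure_of M (p ` ((\<Inter>n. C n) \<inter> topspace Y))"
    unfolding eq[OF C] eq[OF Cint] by simp
  then show ?thesis
    unfolding ennreal_image_capacity[OF p, symmetric]
    by (subst (asm) tendsto_ennreal_iff) (simp_all add: image_capacity_def)
qed

end

section \<open>From finitely additive set functions to Borel measures\<close>

text \<open>
  An additive \<open>L\<close> is in general not countably additive on Borel sets, since mass may sit at the
  boundary: \<open>L\<close> of an open set can exceed the supremum over its closed subsets. This supremum is the
  correct value of the measure represented by \<open>L\<close>.
\<close>

definition inner_content :: "'a topology \<Rightarrow> ('a set \<Rightarrow> real) \<Rightarrow> 'a set \<Rightarrow> ennreal" where
  "inner_content Y L U = (SUP C\<in>{C. closedin Y C \<and> C \<subseteq> U}. ennreal (L C))"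

definition outer_content :: "'a topology \<Rightarrow> ('a set \<Rightarrow> real) \<Rightarrow> 'a set \<Rightarrow> ennreal" where
  "outer_content Y L A = (INF U\<in>{U. openin Y U \<and> A \<subseteq> U}. inner_content Y L U)"

lemma inner_content_upper: "closedin Y C \<Longrightarrow> C \<subseteq> U \<Longrightarrow> ennreal (L C) \<le> inner_content Y L U"
  unfolding inner_content_def by (intro SUP_upper) simp

lemma inner_content_le:
  "modular L \<Longrightarrow> inner_content Y L U \<le> ennreal (L U)"
  unfolding inner_content_def modular_def by (intro SUP_least ennreal_leI) (auto dest: monoD)

lemma inner_content_mono: "U \<subseteq> V \<Longrightarrow> inner_content Y L U \<le> inner_content Y L V"
  unfolding inner_content_def by (intro SUP_subset_mono) auto

lemma outer_content_le: "openin Y U \<Longrightarrow> A \<subseteq> U \<Longrightarrow> outer_content Y L A \<le> inner_content Y L U"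
  unfolding outer_content_def by (intro INF_lower) simp

lemma outer_content_open: "openin Y U \<Longrightarrow> outer_content Y L U = inner_content Y L U"
  unfolding outer_content_def by (rule INF_eqI) (auto intro: inner_content_mono)

lemma outer_content_mono: "A \<subseteq> B \<Longrightarrow> outer_content Y L A \<le> outer_content Y L B"
  unfolding outer_content_def by (intro INF_superset_mono) auto

lemma outer_content_less:
  "outer_content Y L A < t \<Longrightarrow> \<exists>U. openin Y U \<and> A \<subseteq> U \<and> inner_content Y L U < t"
  by (auto simp: outer_content_def INF_less_iff)

text \<open>
  Smoothness along closed sets is what makes a finitely additive set function represent a measure. In
  the Riesz theorem it comes from compactness of the space; here it will come from compact fibres.
\<close>

locale smooth_content =
  fixes Y :: "'a topology" and L :: "'a set \<Rightarrow> real"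
  assumes metrizable: "metrizable_space Y"
    and modular: "modular L"
    and smooth: "\<And>C :: nat \<Rightarrow> 'a set. (\<And>n. closedin Y (C n)) \<Longrightarrow> decseq C \<Longrightarrow> (\<Inter>n. C n) = {}
      \<Longrightarrow> (\<lambda>n. L (C n)) \<longlonglongrightarrow> 0"
begin

lemma L_nonneg: "0 \<le> L A"
  by (rule submodular_nonneg[OF modular_imp_submodular[OF modular]])

text \<open>
  The sets \<open>W k\<close> are finite unions of interiors of closed sets \<open>D i k \<subseteq> U i\<close> and increase to \<open>\<Union>U n\<close>. A closed
  \<open>C \<subseteq> \<Union>U n\<close> is covered by \<open>D 0 k, \<dots>, D (k-1) k\<close> and the remainder \<open>C - W k\<close>, on which \<open>L\<close> tends to 0
  by smoothness.
\<close>

lemma inner_content_countably_subadditive: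
  assumes U: "\<And>n::nat. openin Y (U n)"
  shows "inner_content Y L (\<Union>n. U n) \<le> (\<Sum>n. inner_content Y L (U n))"
proof -
  have "\<exists>D::nat \<Rightarrow> 'a set. (\<forall>m. closedin Y (D m)) \<and> incseq D \<and> (\<forall>m. D m \<subseteq> U n) \<and> (\<Union>m. Y interior_of D m) = U n" for n
    using metrizable_open_exhaustion[OF metrizable U[of n]] by metis
  then obtain D :: "nat \<Rightarrow> nat \<Rightarrow> 'a set" where D: "\<And>n m. closedin Y (D n m)" "\<And>n. incseq (D n)"
      "\<And>n m. D n m \<subseteq> U n" "\<And>n. (\<Union>m. Y interior_of D n m) = U n"
    by metis
  define W where "W k = (\<Union>i<k. Y interior_of D i k)" for k
  have W_open: "openin Y (W k)" for k
    unfolding W_def by (intro openin_Union) auto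
  have W_inc: "incseq W"
  proof (rule incseq_SucI)
    fix k
    have "Y interior_of D i k \<subseteq> Y interior_of D i (Suc k)" for i
      using incseqD[OF D(2)] by (intro interior_of_mono) simp
    then show "W k \<subseteq> W (Suc k)" unfolding W_def by fastforce
  qed
  have W_cover: "(\<Union>n. U n) \<subseteq> (\<Union>k. W k)"
  proof
    fix y assume "y \<in> (\<Union>n. U n)"
    then obtain n m where y: "y \<in> Y interior_of D n m" using D(4) by blast
    have "Y interior_of D n m \<subseteq> Y interior_of D n (max m (Suc n))"
      using incseqD[OF D(2), of m "max m (Suc n)"] by (intro interior_of_mono) simp
    then have "y \<in> W (max m (Suc n))"
      using y unfolding W_def by (intro UN_I[of n]) auto
    then show "y \<in> (\<Union>k. W k)" by blast
  qed
  show ?thesis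
    unfolding inner_content_def[of Y L "\<Union>n. U n"]
  proof (rule SUP_least)
    fix C assume "C \<in> {C. closedin Y C \<and> C \<subseteq> (\<Union>n. U n)}"
    then have C: "closedin Y C" "C \<subseteq> (\<Union>n. U n)" by auto
    have closed: "closedin Y (C - W k)" for k
      using C W_open by (intro closedin_diff)
    have "decseq (\<lambda>k. C - W k)" using W_inc unfolding incseq_def decseq_def by blast
    moreover have "(\<Inter>k. C - W k) = {}" using C W_cover by auto
    ultimately have lim: "(\<lambda>k. L (C - W k)) \<longlonglongrightarrow> 0"
      using closed by (intro smooth)
    have bound: "ennreal (L C) \<le> ennreal (L (C - W k)) + (\<Sum>n. inner_content Y L (U n))" for k
    proof -
      have "C \<subseteq> (C - W k) \<union> (\<Union>i<k. D i k)"
        unfolding W_def using interior_of_subset by fastforce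
      then have "L C \<le> L ((C - W k) \<union> (\<Union>i<k. D i k))"
        using modular by (auto simp: modular_def dest: monoD)
      also have "\<dots> \<le> L (C - W k) + (\<Sum>i<k. L (D i k))"
        using modular_Un_le[OF modular, of "C - W k" "\<Union>i<k. D i k"]
          modular_UN_le[OF _ modular, of "{..<k}" "\<lambda>i. D i k"] by simp
      finally have "ennreal (L C) \<le> ennreal (L (C - W k)) + (\<Sum>i<k. ennreal (L (D i k)))"
        using L_nonneg by (simp add: sum_ennreal ennreal_plus[symmetric] sum_nonneg ennreal_leI del: ennreal_plus)
      also have "(\<Sum>i<k. ennreal (L (D i k))) \<le> (\<Sum>i<k. inner_content Y L (U i))"
        using D by (intro sum_mono inner_content_upper)
      also have "\<dots> \<le> (\<Sum>n. inner_content Y L (U n))"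
        by (intro sum_le_suminf) auto
      finally show ?thesis by (simp add: add_left_mono)
    qed
    have "(\<lambda>k. ennreal (L (C - W k)) + (\<Sum>n. inner_content Y L (U n)))
        \<longlonglongrightarrow> ennreal 0 + (\<Sum>n. inner_content Y L (U n))"
      by (intro tendsto_add tendsto_ennrealI lim tendsto_const)
    then show "ennreal (L C) \<le> (\<Sum>n. inner_content Y L (U n))"
      using bound LIMSEQ_le_const by fastforce
  qed
qed

lemma outer_content_outer_measure:
  "outer_measure_space (Pow (topspace Y)) (outer_content Y L)"
proof -
  have "outer_content Y L {} = 0"
    using inner_content_le[OF modular, of Y "{}"] modular
    by (simp add: outer_content_open modular_def)
  moreover have "countably_subadditive (Pow (topspace Y)) (outer_content Y L)"
    unfolding countably_subadditive_def
  proof (intro allI impI, rule ennreal_le_epsilon)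
    fix A :: "nat \<Rightarrow> 'a set" and e :: real
    assume fin: "(\<Sum>n. outer_content Y L (A n)) < top" and "0 < e"
    have "outer_content Y L (A n) < outer_content Y L (A n) + e * (1/2) ^ Suc n" for n
      using \<open>0 < e\<close> fin by (auto simp add: less_top dest!: ennreal_suminf_lessD)
    then have "\<exists>U. openin Y U \<and> A n \<subseteq> U \<and> inner_content Y L U < outer_content Y L (A n) + e * (1/2) ^ Suc n" for n
      by (intro outer_content_less)
    then obtain U where U: "\<And>n. openin Y (U n)" "\<And>n. A n \<subseteq> U n"
      "\<And>n. inner_content Y L (U n) < outer_content Y L (A n) + e * (1/2) ^ Suc n"
      by metis
    have "outer_content Y L (\<Union>n. A n) \<le> inner_content Y L (\<Union>n. U n)"
      using U by (intro outer_content_le) auto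
    also have "\<dots> \<le> (\<Sum>n. inner_content Y L (U n))"
      using U(1) by (rule inner_content_countably_subadditive)
    also have "\<dots> \<le> (\<Sum>n. outer_content Y L (A n) + e * (1/2) ^ Suc n)"
      using U(3) by (intro suminf_le) (auto intro: less_imp_le)
    also have "\<dots> = (\<Sum>n. outer_content Y L (A n)) + (\<Sum>n. ennreal e * ennreal ((1/2) ^ Suc n))"
      using \<open>0 < e\<close> by (subst suminf_add[symmetric])
        (auto simp del: ennreal_suminf_cmult simp add: ennreal_mult[symmetric])
    also have "\<dots> = (\<Sum>n. outer_content Y L (A n)) + e"
      unfolding ennreal_suminf_cmult
      by (subst suminf_ennreal_eq[OF zero_le_power power_half_series]) auto
    finally show "outer_content Y L (\<Union>n. A n) \<le> (\<Sum>n. outer_content Y L (A n)) + e" .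
  qed
  ultimately show ?thesis
    unfolding outer_measure_space_def positive_def increasing_def
    by (simp add: outer_content_mono)
qed

text \<open>
  Caratheodory's criterion: first exhaust \<open>U \<inter> G\<close> by a closed set \<open>C\<close>, then the open set \<open>G - C\<close>
  by a closed set \<open>C'\<close>; these are disjoint closed subsets of \<open>G\<close>, so their \<open>L\<close>-values add up to at most
  the content of \<open>G\<close>.
\<close>

lemma open_in_lambda_system:
  assumes U: "openin Y U"
  shows "U \<in> lambda_system (topspace Y) (Pow (topspace Y)) (outer_content Y L)"
proof -
  have UY: "U \<subseteq> topspace Y" using U by (rule openin_subset)
  have "outer_content Y L (U \<inter> A) + outer_content Y L ((topspace Y - U) \<inter> A) = outer_content Y L A"
    if A: "A \<subseteq> topspace Y" for A
  proof (rule antisym)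
    have split: "outer_content Y L (U \<inter> A) + outer_content Y L ((topspace Y - U) \<inter> A) \<le> inner_content Y L G"
      if G: "openin Y G" "A \<subseteq> G" for G
    proof -
      have *: "outer_content Y L ((topspace Y - U) \<inter> A) + ennreal (L C) \<le> inner_content Y L G"
        if C: "closedin Y C" "C \<subseteq> U \<inter> G" for C
      proof -
        have "ennreal (L C') + ennreal (L C) \<le> inner_content Y L G" if C': "closedin Y C'" "C' \<subseteq> G - C" for C'
        proof -
          have "C' \<inter> C = {}" using C' by blast
          then have "ennreal (L C') + ennreal (L C) = ennreal (L (C' \<union> C))"
            using modular_disjoint_Un[OF modular, of C' C] L_nonneg by (simp add: ennreal_plus)
          also have "\<dots> \<le> inner_content Y L G"
            using C C' by (intro inner_content_upper closedin_Un) auto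
          finally show ?thesis .
        qed
        then have "(SUP C'\<in>{C'. closedin Y C' \<and> C' \<subseteq> G - C}. ennreal (L C') + ennreal (L C)) \<le> inner_content Y L G"
          by (intro SUP_least) auto
        then have "inner_content Y L (G - C) + ennreal (L C) \<le> inner_content Y L G"
          unfolding inner_content_def[of Y L "G - C"]
          by (subst ennreal_SUP_add_left[symmetric]) (use closedin_empty in blast)+
        moreover have "outer_content Y L ((topspace Y - U) \<inter> A) \<le> inner_content Y L (G - C)"
        proof (rule outer_content_le)
          show "openin Y (G - C)" using G(1) C(1) by (rule openin_diff)
          show "(topspace Y - U) \<inter> A \<subseteq> G - C" using G(2) C(2) by blast
        qed
        ultimately show ?thesis by (rule order_trans[OF add_right_mono, rotated])
      qed
      then have "(SUP C\<in>{C. closedin Y C \<and> C \<subseteq> U \<inter> G}. outer_content Y L ((topspace Y - U) \<inter> A) + ennreal (L C)) \<le> inner_content Y L G"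
        by (intro SUP_least) auto
      then have "outer_content Y L ((topspace Y - U) \<inter> A) + inner_content Y L (U \<inter> G) \<le> inner_content Y L G"
        unfolding inner_content_def[of Y L "U \<inter> G"]
        by (subst ennreal_SUP_add_right) (use closedin_empty in blast)+
      moreover have "outer_content Y L (U \<inter> A) \<le> inner_content Y L (U \<inter> G)"
      proof (rule outer_content_le)
        show "openin Y (U \<inter> G)" using U G(1) by (rule openin_Int)
        show "U \<inter> A \<subseteq> U \<inter> G" using G(2) by blast
      qed
      ultimately show ?thesis
        by (subst add.commute) (rule order_trans[OF add_left_mono])
    qed
    show "outer_content Y L (U \<inter> A) + outer_content Y L ((topspace Y - U) \<inter> A) \<le> outer_content Y L A"
      unfolding outer_content_def[of Y L A] using split by (intro INF_greatest) auto
  next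
    interpret Pw: sigma_algebra "topspace Y" "Pow (topspace Y)" by (rule sigma_algebra_Pow)
    have "subadditive (Pow (topspace Y)) (outer_content Y L)"
      using outer_content_outer_measure unfolding outer_measure_space_def
      by (intro Pw.countably_subadditive_subadditive) auto
    then have "outer_content Y L ((U \<inter> A) \<union> ((topspace Y - U) \<inter> A)) \<le> outer_content Y L (U \<inter> A) + outer_content Y L ((topspace Y - U) \<inter> A)"
      by (rule subadditiveD) (use UY A in auto)
    moreover have "(U \<inter> A) \<union> ((topspace Y - U) \<inter> A) = A" using A by auto
    ultimately show "outer_content Y L A \<le> outer_content Y L (U \<inter> A) + outer_content Y L ((topspace Y - U) \<inter> A)"
      by simp
  qed
  then show ?thesis using UY by (simp add: lambda_system_def)
qed

theorem representing_measure:
  obtains \<nu> where "sets \<nu> = sets (borel_of Y)"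
    "\<And>U. openin Y U \<Longrightarrow> emeasure \<nu> U = inner_content Y L U"
proof -
  let ?\<Lambda> = "lambda_system (topspace Y) (Pow (topspace Y)) (outer_content Y L)"
  let ?B = "sets (borel_of Y)"
  interpret Pw: sigma_algebra "topspace Y" "Pow (topspace Y)" by (rule sigma_algebra_Pow)
  have ms: "measure_space (topspace Y) ?\<Lambda> (outer_content Y L)"
    by (rule Pw.caratheodory_lemma[OF outer_content_outer_measure])
  then have "sigma_algebra (topspace Y) ?\<Lambda>" by (simp add: measure_space_def)
  then have "?B \<subseteq> ?\<Lambda>"
    unfolding sets_borel_of
    by (rule sigma_algebra.sigma_sets_subset) (use open_in_lambda_system in blast)
  moreover have sa: "sigma_algebra (topspace Y) ?B"
    using sets.sigma_algebra_axioms[of "borel_of Y"] by (simp add: space_borel_of)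
  ultimately have msB: "measure_space (topspace Y) ?B (outer_content Y L)"
    using measure_down[OF ms] by simp
  define \<nu> where "\<nu> = measure_of (topspace Y) ?B (outer_content Y L)"
  show thesis
  proof
    show sets: "sets \<nu> = ?B"
      unfolding \<nu>_def using sa by (rule sigma_algebra.sets_measure_of_eq)
    fix U assume U: "openin Y U"
    then have UB: "U \<in> ?B" unfolding sets_borel_of by blast
    have "emeasure \<nu> U = outer_content Y L U"
      unfolding \<nu>_def
      by (rule emeasure_measure_of_sigma[OF sa _ _ UB]) (use msB in \<open>simp_all add: measure_space_def\<close>)
    then show "emeasure \<nu> U = inner_content Y L U" using outer_content_open[OF U] by simp
  qed
qed

end

text \<open>
  The measure \<open>\<nu>\<close> dominates \<open>L\<close> on closed sets, so \<open>L \<le> c\<close> does not bound \<open>\<nu> C\<close> directly. It does on open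
  neighbourhoods of \<open>C\<close>; enclosing these in closed sets \<open>K m\<close> that decrease to \<open>C\<close> and using the
  continuity of \<open>c\<close> gives the bound.
\<close>

lemma representing_measure_closed_le:
  assumes Y: "metrizable_space Y" and L: "modular L" and "L \<le> c"
    and cont: "\<And>C. (\<And>n::nat. closedin Y (C n)) \<Longrightarrow> decseq C \<Longrightarrow> (\<lambda>n. c (C n)) \<longlonglongrightarrow> c (\<Inter>n. C n)"
    and sets: "sets \<nu> = sets (borel_of Y)"
    and \<nu>: "\<And>U. openin Y U \<Longrightarrow> emeasure \<nu> U = inner_content Y L U"
    and C: "closedin Y C"
  shows "emeasure \<nu> C \<le> ennreal (c C)"
proof -
  have U: "openin Y (topspace Y - C)" using C by blast
  obtain D where D: "\<And>m. closedin Y (D m)" "incseq D" "\<And>m. D m \<subseteq> topspace Y - C"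
      "(\<Union>m. Y interior_of D m) = topspace Y - C"
    using metrizable_open_exhaustion[OF Y U] by metis
  define K where "K m = topspace Y - Y interior_of D m" for m
  have K: "closedin Y (K m)" for m unfolding K_def by (intro closedin_diff) auto
  have "decseq K"
    using interior_of_mono[OF incseqD[OF D(2)], of _ _ Y] unfolding decseq_def K_def by blast
  moreover have "(\<Inter>m. K m) = C"
    using D(4) closedin_subset[OF C] by (auto simp: K_def)
  ultimately have "(\<lambda>m. c (K m)) \<longlonglongrightarrow> c C"
    using cont[of K, OF K] by simp
  then have "(\<lambda>m. ennreal (c (K m))) \<longlonglongrightarrow> ennreal (c C)" by (rule tendsto_ennrealI)
  moreover have "emeasure \<nu> C \<le> ennreal (c (K m))" for m
  proof -
    have G: "openin Y (topspace Y - D m)" using D(1) by blast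
    have "emeasure \<nu> C \<le> emeasure \<nu> (topspace Y - D m)"
      using D(3)[of m] closedin_subset[OF C] open_measurable_borel_of[OF G] sets by (intro emeasure_mono) auto
    also have "\<dots> \<le> ennreal (L (topspace Y - D m))"
      using \<nu>[OF G] inner_content_le[OF L] by simp
    also have "\<dots> \<le> ennreal (L (K m))"
    proof -
      have "topspace Y - D m \<subseteq> K m" using interior_of_subset[of Y "D m"] by (auto simp: K_def)
      then show ?thesis using L by (intro ennreal_leI) (auto simp: modular_def dest: monoD)
    qed
    also have "\<dots> \<le> ennreal (c (K m))" using \<open>L \<le> c\<close> by (intro ennreal_leI) (simp add: le_fun_def)
    finally show ?thesis .
  qed
  ultimately show ?thesis using LIMSEQ_le_const by blast
qed

section \<open>The invariant lift\<close>

theorem theorem1: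
  fixes \<mu> :: "'a measure" and T :: "'a \<Rightarrow> 'a"
    and Y :: "'b topology" and S :: "'b \<Rightarrow> 'b" and p :: "'b \<Rightarrow> 'a"
  assumes "standard_borel_space \<mu>" and "prob_space \<mu>"
    and "T \<in> measurable (completion \<mu>) \<mu>"
    and "\<And>A. A \<in> sets \<mu> \<Longrightarrow> emeasure (completion \<mu>) (T -` A \<inter> space \<mu>) = emeasure \<mu> A"
    and "polish_topology Y"
    and "continuous_map Y Y S"
    and "p \<in> measurable (borel_of Y) \<mu>"
    and "\<And>y. y \<in> topspace Y \<Longrightarrow> p (S y) = T (p y)"
    and "emeasure (completion \<mu>) (p ` topspace Y) = 1"
    and "AE x in \<mu>. compactin Y {y \<in> topspace Y. p y = x}"
  shows "\<exists>\<nu> :: 'b measure. sets \<nu> = sets (borel_of Y) \<and> prob_space \<nu> \<and>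
           distr \<nu> (borel_of Y) S = \<nu> \<and> distr \<nu> \<mu> p = \<mu>"
proof -
  note p = assms(7)
  interpret \<mu>: prob_space \<mu> by fact
  have Y: "metrizable_space Y"
    using assms(5) by (simp add: polish_topology_def completely_metrizable_imp_metrizable_space)
  have pY: "p ` topspace Y \<subseteq> space \<mu>"
    using measurable_space[OF p] by (auto simp: space_borel_of)
  have SY: "S y \<in> topspace Y" if "y \<in> topspace Y" for y
    using continuous_map_image_subset_topspace[OF assms(6)] that by blast
  obtain B :: "nat \<Rightarrow> 'a set" where B: "\<And>i. B i \<in> sets \<mu>"
    "\<And>x y. x \<in> space \<mu> \<Longrightarrow> y \<in> space \<mu> \<Longrightarrow> (\<And>i. x \<in> B i \<longleftrightarrow> y \<in> B i) \<Longrightarrow> x = y"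
    using standard_borel_separating_sequence[OF assms(1)] by metis
  have meas: "p ` C \<in> sets (completion \<mu>)" if "closedin Y C" for C
    by (rule borel_image_closed_completion_measurable[OF \<mu>.finite_measure_axioms B assms(5) p that])
  define c where "c = image_capacity \<mu> p (topspace Y)"
  have c_enn: "ennreal (c A) = outer_measure_of \<mu> (p ` (A \<inter> topspace Y))" for A
    unfolding c_def by (rule \<mu>.ennreal_image_capacity[OF pY])
  have c_nonneg: "0 \<le> c A" for A by (simp add: c_def image_capacity_def)
  have c_sub: "submodular c" unfolding c_def by (rule \<mu>.submodular_image_capacity[OF pY])
  have c_lim: "(\<lambda>n. c (C n)) \<longlonglongrightarrow> c (\<Inter>n. C n)" if "\<And>n::nat. closedin Y (C n)" "decseq C" for C
    unfolding c_def by (rule \<mu>.image_capacity_decseq_closed[OF pY meas assms(10) that])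
  have "ennreal (c UNIV) = 1"
    using c_enn[of UNIV] emeasure_completion_eq_outer_measure_of[OF meas[OF closedin_topspace]] assms(9)
    by simp
  then have c_UNIV: "c UNIV = 1" by simp
  have c_inv: "c (S -` A) \<le> c A" for A
  proof -
    have "p ` (S -` A \<inter> topspace Y) \<subseteq> T -` (p ` (A \<inter> topspace Y)) \<inter> space \<mu>"
      using SY pY assms(8) by (auto simp: image_subset_iff) (metis IntI image_eqI)
    then have "ennreal (c (S -` A)) \<le> outer_measure_of \<mu> (T -` (p ` (A \<inter> topspace Y)) \<inter> space \<mu>)"
      unfolding c_enn by (rule outer_measure_of_mono)
    also have "\<dots> \<le> ennreal (c A)"
      unfolding c_enn using pY by (intro outer_measure_of_vimage_le assms) auto
    finally show ?thesis using c_nonneg by simp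
  qed
  obtain m where m: "modular m" "m UNIV = c UNIV" "m \<le> c"
    using submodular_dominates_modular[OF c_sub] by metis
  obtain L where L: "modular L" "L UNIV = 1" "L \<le> c" "\<And>A. L (S -` A) = L A"
    using modular_invariant_limit[OF m(1) _ m(3) c_inv] m(2) c_UNIV by metis
  have L_nonneg: "0 \<le> L A" for A
    by (rule submodular_nonneg[OF modular_imp_submodular[OF L(1)]])
  have L_Compl: "L (- topspace Y) = 0"
  proof -
    have "L (- topspace Y) \<le> c (- topspace Y)" using L(3) by (simp add: le_fun_def)
    also have "\<dots> = 0" by (simp add: c_def image_capacity_def)
    finally show ?thesis using L_nonneg by (simp add: order_antisym)
  qed
  have L_Int: "L (A \<inter> topspace Y) = L A" for A
  proof -
    have mono: "mono L" using L(1) by (simp add: modular_def)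
    have "L A \<le> L ((A \<inter> topspace Y) \<union> - topspace Y)" "L (A \<inter> topspace Y) \<le> L A"
      by (rule monoD[OF mono], blast)+
    moreover have "L ((A \<inter> topspace Y) \<union> - topspace Y) \<le> L (A \<inter> topspace Y) + L (- topspace Y)"
      by (rule modular_Un_le[OF L(1)])
    ultimately show ?thesis using L_Compl by simp
  qed
  interpret smooth_content Y L
  proof
    fix C :: "nat \<Rightarrow> 'b set"
    assume C: "\<And>n. closedin Y (C n)" "decseq C" "(\<Inter>n. C n) = {}"
    have "(\<lambda>n. c (C n)) \<longlonglongrightarrow> 0"
      using c_lim[OF C(1,2)] C(3) c_sub by (simp add: submodular_def)
    then show "(\<lambda>n. L (C n)) \<longlonglongrightarrow> 0"
      by (rule Lim_null_comparison[rotated]) (use L_nonneg L(3) in \<open>simp add: le_fun_def\<close>)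
  qed (fact Y L)+
  obtain \<nu> where sets: "sets \<nu> = sets (borel_of Y)"
    and \<nu>: "\<And>U. openin Y U \<Longrightarrow> emeasure \<nu> U = inner_content Y L U"
    using representing_measure by metis
  have space: "space \<nu> = topspace Y"
    using sets_eq_imp_space_eq[OF sets] by (simp add: space_borel_of)
  have "emeasure \<nu> (topspace Y) = 1"
  proof (rule antisym)
    have "L (topspace Y) = 1" using L_Int[of UNIV] L(2) by simp
    then show "emeasure \<nu> (topspace Y) \<le> 1" "1 \<le> emeasure \<nu> (topspace Y)"
      using \<nu>[OF openin_topspace] inner_content_le[OF L(1), of Y "topspace Y"]
        inner_content_upper[OF closedin_topspace, of Y "topspace Y" L] by simp_all
  qed
  then interpret \<nu>: prob_space \<nu> by (intro prob_spaceI) (simp add: space)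
  have \<nu>_closed: "\<nu>.prob C \<le> c C" if "closedin Y C" for C
    using representing_measure_closed_le[OF Y L(1,3) c_lim sets \<nu> that] c_nonneg[of C]
    by (simp add: \<nu>.emeasure_eq_measure)

  have S_borel: "S \<in> measurable \<nu> (borel_of Y)"
    unfolding borel_of_def
  proof (rule measurable_measure_of)
    fix U assume "U \<in> {U. openin Y U}"
    then have "openin Y {y \<in> topspace Y. S y \<in> U}"
      using openin_continuous_map_preimage[OF assms(6)] by blast
    moreover have "S -` U \<inter> space \<nu> = {y \<in> topspace Y. S y \<in> U}" using space by auto
    ultimately show "S -` U \<inter> space \<nu> \<in> sets \<nu>"
      using open_measurable_borel_of sets by auto
  qed (use SY space in \<open>auto dest: openin_subset\<close>)
  interpret S\<nu>: prob_space "distr \<nu> (borel_of Y) S" by (rule \<nu>.prob_space_distr[OF S_borel])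
  have S_open: "\<nu>.prob U \<le> S\<nu>.prob U" if U: "openin Y U" for U
  proof -
    have V: "openin Y {y \<in> topspace Y. S y \<in> U}"
      using openin_continuous_map_preimage[OF assms(6) U] .
    have "inner_content Y L U \<le> inner_content Y L {y \<in> topspace Y. S y \<in> U}"
      unfolding inner_content_def[of Y L U]
    proof (rule SUP_least)
      fix C assume "C \<in> {C. closedin Y C \<and> C \<subseteq> U}"
      then have C: "closedin Y C" "C \<subseteq> U" by auto
      \<comment> \<open>By continuity of \<open>S\<close> the preimage of the closed set \<open>C\<close> is closed, hence admissible in the
        supremum that defines the content of \<open>S\<inverse>(U)\<close>.\<close>
      have "L C = L (S -` C \<inter> topspace Y)" using L(4) L_Int by simp
      also have "S -` C \<inter> topspace Y = {y \<in> topspace Y. S y \<in> C}" by auto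
      finally have eq: "L C = L {y \<in> topspace Y. S y \<in> C}" .
      have "{y \<in> topspace Y. S y \<in> C} \<subseteq> {y \<in> topspace Y. S y \<in> U}" using C(2) by blast
      then show "ennreal (L C) \<le> inner_content Y L {y \<in> topspace Y. S y \<in> U}"
        unfolding eq
        by (rule inner_content_upper[OF closedin_continuous_map_preimage[OF assms(6) C(1)]])
    qed
    then have "emeasure \<nu> U \<le> emeasure \<nu> {y \<in> topspace Y. S y \<in> U}"
      using \<nu>[OF U] \<nu>[OF V] by simp
    also have "{y \<in> topspace Y. S y \<in> U} = S -` U \<inter> space \<nu>" using space by auto
    also have "emeasure \<nu> (S -` U \<inter> space \<nu>) = emeasure (distr \<nu> (borel_of Y) S) U"
      using open_measurable_borel_of[OF U] S_borel by (simp add: emeasure_distr)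
    finally show ?thesis by (simp add: \<nu>.emeasure_eq_measure S\<nu>.emeasure_eq_measure)
  qed
  have S_closed: "S\<nu>.prob C \<le> \<nu>.prob C" if C: "closedin Y C" for C
  proof -
    have "openin Y (topspace Y - C)" using C by blast
    from S_open[OF this] show ?thesis
      using \<nu>.prob_compl[of C] S\<nu>.prob_compl[of C] closed_measurable_borel_of[OF C] sets space
      by (simp add: space_borel_of)
  qed
  have "distr \<nu> (borel_of Y) S = \<nu>"
  proof (rule prob_space_eqI_le)
    fix E assume E: "E \<in> sets \<nu>"
    show "S\<nu>.prob E \<le> \<nu>.prob E"
    proof (rule field_le_epsilon)
      fix e :: real assume "0 < e"
      obtain C where C: "closedin Y C" "C \<subseteq> E" "S\<nu>.prob E < S\<nu>.prob C + e"
        using closed_inner_regular[OF Y S\<nu>.finite_measure_axioms _ _ \<open>0 < e\<close>, of E] E sets by auto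
      have "\<nu>.prob C \<le> \<nu>.prob E"
        using C(2) E by (intro \<nu>.finite_measure_mono)
      with S_closed[OF C(1)] C(3) show "S\<nu>.prob E \<le> \<nu>.prob E + e" by simp
    qed
  qed (simp_all add: sets \<nu>.prob_space_axioms S\<nu>.prob_space_axioms)

  moreover have p_borel: "p \<in> measurable \<nu> \<mu>"
    using p measurable_cong_sets[OF sets refl] by blast
  interpret p\<nu>: prob_space "distr \<nu> \<mu> p" by (rule \<nu>.prob_space_distr[OF p_borel])
  have "distr \<nu> \<mu> p = \<mu>"
  proof (rule prob_space_eqI_le)
    fix A assume A: "A \<in> sets \<mu>"
    let ?E = "p -` A \<inter> topspace Y"
    have E: "?E \<in> sets \<nu>" using measurable_sets[OF p_borel A] by (simp add: space)
    show "p\<nu>.prob A \<le> \<mu>.prob A"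
    proof (rule field_le_epsilon)
      fix e :: real assume "0 < e"
      obtain C where C: "closedin Y C" "C \<subseteq> ?E" "\<nu>.prob ?E < \<nu>.prob C + e"
        using closed_inner_regular[OF Y \<nu>.finite_measure_axioms sets E \<open>0 < e\<close>] by blast
      have "outer_measure_of \<mu> (p ` (C \<inter> topspace Y)) \<le> outer_measure_of \<mu> A"
        using C(2) by (intro outer_measure_of_mono) auto
      then have "c C \<le> \<mu>.prob A"
        unfolding c_enn[symmetric] using A by (simp add: \<mu>.emeasure_eq_measure)
      then show "p\<nu>.prob A \<le> \<mu>.prob A + e"
        using \<nu>_closed[OF C(1)] C(3) measure_distr[OF p_borel A] by (simp add: space)
    qed
  qed (simp_all add: assms(2) p\<nu>.prob_space_axioms)
  ultimately show ?thesis using sets \<nu>.prob_space_axioms by blast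
qed

end
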